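(* Let $A \in \mathbb{R}^{m \times n}$, $\vec b\in\mathbb{R}^n$, and let $\sigma_1$, $\sigma_n$ and $\sigma_m$ be the first, $n$-th and $m$-th singular value of $A$, respectively. Let $\bar{\vec y}_k = P_k f^\diamond(B_k) Q_k^T \vec b$, with $B_k=P_k^TAQ_k$, be the rational Krylov approximation to $\vec y = f^\diamond(A) \vec b$ from $\mathcal{Q}_k(AA^T, A \vec b)$. Then $$\| f^\diamond(A) \vec b - \bar{\vec y}_k \|_2 \le 2 \|\vec b\|_2 \min_{p \in \Pi_{k-1}} \| f(z) - q_{k-1}(z^2)^{-1} p(z^2) z \|_{\infty, [\sigma_n, \sigma_1]}.$$ Moreover, if $A$ is square with $\sigma_m = \sigma_n > 0$, or if $\lim_{z \to 0} \frac{f(z)}{z} = 0$, it also holds that $$\| f^\diamond(A) \vec b - \bar{\vec y}_k \|_2 \le 2 \|A \vec b\|_2 \min_{p \in \Pi_{k-1}} \| f(z)/z - q_{k-1}(z^2)^{-1} p(z^2) \|_{\infty, [\sigma_{\max\{m,n\}}, \sigma_1]}.$$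
   Context: Generalized matrix function: let $A\in\mathbb{R}^{m\times n}$ have rank $r$ and compact SVD $A = U_r\Sigma_r V_r^T$, with $\Sigma_r=\mathrm{diag}(\sigma_1,\dots,\sigma_r)$, $\sigma_1\ge\dots\ge\sigma_r>0$, and $U_r\in\mathbb{R}^{m\times r}$, $V_r\in\mathbb{R}^{n\times r}$ with orthonormal columns. For $f$ defined on $\{\sigma_1,\dots,\sigma_r\}$, $f^\diamond(A) = U_r f(\Sigma_r)V_r^T$ with $f(\Sigma_r)=\mathrm{diag}(f(\sigma_1),\dots,f(\sigma_r))$. Since $f^\diamond(A)$ depends only on values of $f$ at the nonzero singular values, $f$ is by convention taken to satisfy $f(0)=0$. Singular values: listed in nonincreasing order $\sigma_1\ge\dots\ge\sigma_{\min\{m,n\}}\ge 0$, with the convention $\sigma_j := 0$ for $\min\{m,n\}<j\le\max\{m,n\}$. $\Pi_{k-1}$ is the set of polynomials of degree $\le k-1$, and $\|h\|_{\infty,I}=\sup_{z\in I}|h(z)|$. The function $f$ is real-valued and defined on the interval appearing in the respective bound. When $\lim_{z\to0}f(z)/z=0$, the value of $f(z)/z$ at $z=0$ is taken to be $0$. The rational functions $p/q_{k-1}$ are understood in lowest terms; the norm is $+\infty$ if a pole remains on the interval. Rational Krylov subspaces: given poles $\xi_1,\dots,\xi_{k-1}\in \mathbb{C}\cup\{\infty\}$ that are not eigenvalues of $A^TA$ or $AA^T$, let $q_{k-1}(z)=\prod_{j=1}^{k-1}(1-z/\xi_j)$, where the factor is $1$ if $\xi_j=\infty$ (multiplying $q_{k-1}$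 by a nonzero constant changes nothing, so finite factors may equivalently be written $z-\xi_j$, which also covers $\xi_j=0$). For a square matrix $M$ and vector $\vec c$, $\mathcal{Q}_k(M,\vec c)=q_{k-1}(M)^{-1}\,\mathrm{span}\{\vec c,M\vec c,\dots,M^{k-1}\vec c\}$. Rational Krylov approximation: $Q_k\in\mathbb{R}^{n\times k}$ and $P_k\in\mathbb{R}^{m\times k}$ are real matrices with orthonormal columns forming bases of $\mathcal{Q}_k(A^TA,\vec b)$ and $\mathcal{Q}_k(AA^T,A\vec b)$ respectively, both subspaces being built with the same poles and assumed to have dimension $k$ (spans are over $\mathbb{C}$ if some poles are non-real; the poles are such that real bases exist, e.g. real poles). *)

theory Defs
  imports
    "HOL-Library.Extended_Nonnegative_Real"
    "HOL-Computational_Algebra.Field_as_Ring"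
    "HOL-Computational_Algebra.Polynomial_Factorial"
    "Jordan_Normal_Form.VS_Connect"
    "Jordan_Normal_Form.Gauss_Jordan_Elimination"
    "Jordan_Normal_Form.Char_Poly"
begin

definition norm2 :: "real vec \<Rightarrow> real" where
  "norm2 v = sqrt (v \<bullet> v)"

abbreviation cmat :: "real mat \<Rightarrow> complex mat" where
  "cmat \<equiv> map_mat complex_of_real"

abbreviation cvec :: "real vec \<Rightarrow> complex vec" where
  "cvec \<equiv> map_vec complex_of_real"

section \<open>Generalized matrix functions\<close>

text \<open>The diagonal of the middle factor is \<open>s 0, \<dots>, s (r - 1)\<close>; the values \<open>s i\<close> for
  \<open>i \<ge> r\<close> are irrelevant. Positivity of these entries forces \<open>r\<close> to be the rank.\<close>

definition is_compact_svd ::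
  "real mat \<Rightarrow> nat \<Rightarrow> real mat \<Rightarrow> (nat \<Rightarrow> real) \<Rightarrow> real mat \<Rightarrow> bool" where
  "is_compact_svd A r U s V \<longleftrightarrow>
     U \<in> carrier_mat (dim_row A) r \<and> U\<^sup>T * U = 1\<^sub>m r \<and>
     V \<in> carrier_mat (dim_col A) r \<and> V\<^sup>T * V = 1\<^sub>m r \<and>
     (\<forall>i<r. 0 < s i) \<and> (\<forall>i j. i \<le> j \<and> j < r \<longrightarrow> s j \<le> s i) \<and>
     A = U * mat_diag r s * V\<^sup>T"

text \<open>Every real matrix has a compact SVD. It is not unique, but neither the singular values nor
  the matrix \<open>gen_mat_fun f A\<close> depend on the one chosen here.\<close>

definition compact_svd :: "real mat \<Rightarrow> nat \<times> real mat \<times> (nat \<Rightarrow> real) \<times> real mat" where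
  "compact_svd A = (SOME (r, U, s, V). is_compact_svd A r U s V)"

definition gen_mat_fun :: "(real \<Rightarrow> real) \<Rightarrow> real mat \<Rightarrow> real mat" where
  "gen_mat_fun f A =
     (case compact_svd A of (r, U, s, V) \<Rightarrow> U * mat_diag r (\<lambda>i. f (s i)) * V\<^sup>T)"

text \<open>Singular values are numbered from 1. Those beyond the rank are 0, and so is, by convention,
  \<open>sing_val A j\<close> for \<open>j\<close> exceeding one or both of the dimensions.\<close>

definition sing_val :: "real mat \<Rightarrow> nat \<Rightarrow> real" where
  "sing_val A j =
     (case compact_svd A of (r, U, s, V) \<Rightarrow> if 1 \<le> j \<and> j \<le> r then s (j - 1) else 0)"

section \<open>Rational Krylov subspaces\<close>

text \<open>Poles live in the extended complex plane, with \<open>None\<close> for \<open>\<infinity>\<close>. A finite pole \<open>c\<close> contributes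
  the factor \<open>z - c\<close>, a constant multiple of \<open>1 - z / c\<close> that also makes sense for \<open>c = 0\<close>.\<close>

definition pole_poly :: "(nat \<Rightarrow> complex option) \<Rightarrow> nat \<Rightarrow> complex poly" where
  "pole_poly \<xi> k = (\<Prod>j = 1..k - 1. case \<xi> j of None \<Rightarrow> 1 | Some c \<Rightarrow> [:- c, 1:])"

definition poly_mat :: "'a :: comm_ring_1 poly \<Rightarrow> 'a mat \<Rightarrow> 'a mat" where
  "poly_mat p M = mat (dim_row M) (dim_row M)
     (\<lambda>ij. \<Sum>d\<le>degree p. coeff p d * (M ^\<^sub>m d) $$ ij)"

definition vspan :: "nat \<Rightarrow> complex vec set \<Rightarrow> complex vec set" where
  "vspan n = LinearCombinations.module.span class_ring (module_vec TYPE(complex) n)"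

text \<open>Only meaningful if \<open>poly_mat q M\<close> is invertible, i.e. no zero of \<open>q\<close> is an eigenvalue
  of \<open>M\<close>.\<close>

definition rat_krylov :: "complex poly \<Rightarrow> nat \<Rightarrow> complex mat \<Rightarrow> complex vec \<Rightarrow> complex vec set" where
  "rat_krylov q k M c =
     (\<lambda>v. the (mat_inverse (poly_mat q M)) *\<^sub>v v) `
       vspan (dim_row M) ((\<lambda>i. (M ^\<^sub>m i) *\<^sub>v c) ` {..<k})"

text \<open>The \<open>k\<close> columns of the real matrix \<open>Q\<close> are orthonormal and form a basis of the complex
  space \<open>S\<close> (so that \<open>S\<close> has dimension \<open>k\<close>). If \<open>S\<close> is the complexification of a real space, this
  says that they form a basis of that real space.\<close>

definition real_onb :: "nat \<Rightarrow> nat \<Rightarrow> real mat \<Rightarrow> complex vec set \<Rightarrow> bool" where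
  "real_onb n k Q S \<longleftrightarrow>
     Q \<in> carrier_mat n k \<and> Q\<^sup>T * Q = 1\<^sub>m k \<and> vspan n (set (cols (cmat Q))) = S"

section \<open>Rational functions and the supremum norm\<close>

text \<open>The value at \<open>w\<close> of \<open>p / q\<close> in lowest terms; \<open>None\<close> if \<open>w\<close> is a pole.\<close>

definition ratfun_val :: "complex poly \<Rightarrow> complex poly \<Rightarrow> complex \<Rightarrow> complex option" where
  "ratfun_val p q w =
     (let p' = p div gcd p q; q' = q div gcd p q
      in if poly q' w = 0 then None else Some (poly p' w / poly q' w))"

definition sup_norm :: "real set \<Rightarrow> (real \<Rightarrow> complex option) \<Rightarrow> ennreal" where
  "sup_norm I h = (SUP z\<in>I. case h z of None \<Rightarrow> \<infinity> | Some y \<Rightarrow> ennreal (cmod y))"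

text \<open>The two error norms, for a given numerator \<open>p\<close>. In the second one, \<open>f z / z = 0\<close> for
  \<open>z = 0\<close>, by the convention for division in HOL.\<close>

definition err_norm :: "(real \<Rightarrow> real) \<Rightarrow> complex poly \<Rightarrow> real set \<Rightarrow> complex poly \<Rightarrow> ennreal" where
  "err_norm f q I p = sup_norm I (\<lambda>z. map_option
     (\<lambda>y. complex_of_real (f z) - y * complex_of_real z) (ratfun_val p q (complex_of_real (z\<^sup>2))))"

definition err_norm_div :: "(real \<Rightarrow> real) \<Rightarrow> complex poly \<Rightarrow> real set \<Rightarrow> complex poly \<Rightarrow> ennreal" where
  "err_norm_div f q I p = sup_norm I (\<lambda>z. map_option
     (\<lambda>y. complex_of_real (f z / z) - y) (ratfun_val p q (complex_of_real (z\<^sup>2))))"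

end

theory Submission
  imports Defs "HOL-Analysis.L2_Norm" "Jordan_Normal_Form.Schur_Decomposition"
begin

text \<open>
  Write \<open>M = A\<^sup>T * A\<close> and \<open>v\<close> for \<open>b\<close> multiplied by the inverse of \<open>q(M)\<close>. The first rational
  Krylov space is spanned by the vectors \<open>M\<^sup>i * v\<close> with \<open>i < k\<close>, and \<open>A\<close> maps it into the second one,
  so that \<open>P * B = A * Q\<close> and \<open>B\<^sup>T * B = Q\<^sup>T * M * Q\<close>. Hence \<open>p(M) * v = Q * p(B\<^sup>T * B) * Q\<^sup>T * v\<close>
  whenever \<open>p\<close> has degree less than \<open>k\<close>, in particular for \<open>p = q\<close>, and the approximation is exact for
  every function \<open>z * p(z\<^sup>2) / q(z\<^sup>2)\<close> that has no pole at the singular values of \<open>A\<close> and \<open>B\<close>. Moreover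
  \<open>norm2 (B * x) = norm2 (A * Q * x)\<close>, so all positive singular values of \<open>A\<close> and \<open>B\<close> lie in the interval
  of the bound. Subtracting an exactly reproduced function from \<open>f\<close> leaves two terms, each at most the
  maximal deviation times \<open>norm2 b\<close> (or \<open>norm2 (A * b)\<close>, if a factor \<open>z\<close> is split off).
  The infimum over \<open>p\<close> is attained because a pointwise bounded sequence in a finite-dimensional
  space of functions has a pointwise convergent subsequence with limit in that space.
\<close>

section \<open>Euclidean norm and orthonormal columns\<close>

text \<open>Two obstacles shape the details. The poles may be non-real while \<open>Q\<close>,
  \<open>P\<close> and \<open>f\<close> are real, so the Krylov argument runs over the complex
  numbers and its outcome is projected to real parts at the end. And a pole, though no eigenvalue of
  \<open>A\<^sup>T * A\<close>, may well be an eigenvalue of the compressed matrix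
  \<open>B\<^sup>T * B\<close>, so \<open>q(B\<^sup>T * B)\<close> cannot be inverted. What replaces
  the inverse is a single vector, \<open>Q\<^sup>T * v\<close>, that is mapped to
  \<open>Q\<^sup>T * b\<close>, together with relations between \<open>p\<close> and
  \<open>q\<close> in which the denominator is multiplied out; these survive a common root of
  numerator and denominator at a squared singular value. A pole that does not cancel makes the error
  norm infinite, which settles the bound unless the factor in front is 0. Finally, the matrix
  function is defined through a chosen decomposition, about which nothing is known before a compact
  SVD is shown to exist.\<close>

lemma norm2_L2_set: "norm2 v = L2_set (vec_index v) {..<dim_vec v}"
  by (simp add: norm2_def L2_set_def scalar_prod_def power2_eq_square atLeast0LessThan)

lemma norm2_nonneg [simp]: "0 \<le> norm2 v"
  by (simp add: norm2_L2_set L2_set_nonneg)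

lemma norm2_power2: "(norm2 v)\<^sup>2 = v \<bullet> v"
  by (simp add: norm2_def scalar_prod_def sum_nonneg)

lemma norm2_minus_le:
  assumes "u \<in> carrier_vec n" "v \<in> carrier_vec n"
  shows "norm2 (u - v) \<le> norm2 u + norm2 v"
proof -
  have "norm2 (u - v) = L2_set (\<lambda>i. u $ i + - v $ i) {..<n}"
    using assms by (auto simp: norm2_L2_set intro!: L2_set_cong)
  also have "\<dots> \<le> L2_set (vec_index u) {..<n} + L2_set (\<lambda>i. - v $ i) {..<n}"
    by (rule L2_set_triangle_ineq)
  also have "\<dots> = norm2 u + norm2 v"
    using assms by (simp add: norm2_L2_set L2_set_def)
  finally show ?thesis .
qed

lemma norm2_isometry:
  assumes U: "U \<in> carrier_mat n r" "U\<^sup>T * U = 1\<^sub>m r" and x: "x \<in> carrier_vec r"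
  shows "norm2 (U *\<^sub>v x) = norm2 x"
proof -
  have "(U *\<^sub>v x) \<bullet> (U *\<^sub>v x) = (U\<^sup>T *\<^sub>v (U *\<^sub>v x)) \<bullet> x"
    using U(1) x by (subst transpose_vec_mult_scalar[of U n r]) auto
  also have "U\<^sup>T *\<^sub>v (U *\<^sub>v x) = (U\<^sup>T * U) *\<^sub>v x"
    using U(1) x by simp
  finally show ?thesis using U x by (simp add: norm2_def)
qed

text \<open>Bessel's inequality. With \<open>z\<close> the orthogonal projection of \<open>x\<close>
  onto the columns of \<open>V\<close>, both \<open>x \<bullet> z\<close> and
  \<open>z \<bullet> z\<close> equal \<open>y \<bullet> y\<close>, so expanding the square of
  \<open>x - z\<close> leaves exactly the difference of the two squared norms.\<close>

lemma norm2_transpose_le: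
  assumes V: "V \<in> carrier_mat n r" "V\<^sup>T * V = 1\<^sub>m r" and x: "x \<in> carrier_vec n"
  shows "norm2 (V\<^sup>T *\<^sub>v x) \<le> norm2 x"
proof -
  define y where "y = V\<^sup>T *\<^sub>v x"
  define z where "z = V *\<^sub>v y"
  have [simp]: "y \<in> carrier_vec r" "z \<in> carrier_vec n"
    using V x by (auto simp: y_def z_def)
  have zz: "z \<bullet> z = y \<bullet> y"
    using norm2_isometry[OF V, of y] norm2_power2[of y] norm2_power2[of z] by (simp add: z_def)
  have zx: "x \<bullet> z = y \<bullet> y"
    unfolding z_def using V x transpose_vec_mult_scalar[of V n r y x] by (simp add: y_def)
  have "0 \<le> (x - z) \<bullet> (x - z)" by (simp add: norm2_power2 [symmetric])
  also have "\<dots> = x \<bullet> x - x \<bullet> z - (z \<bullet> x - z \<bullet> z)"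
    using x by (subst minus_scalar_prod_distrib[of _ n]) (auto simp: scalar_prod_minus_distrib[of _ n])
  also have "z \<bullet> x = x \<bullet> z" using x by (intro comm_scalar_prod) auto
  finally show ?thesis by (simp add: zz zx norm2_def y_def)
qed

lemma mat_diag_mult_vec_index:
  assumes "x \<in> carrier_vec r" "i < r"
  shows "(mat_diag r h *\<^sub>v x) $ i = h i * x $ i"
proof -
  have "(mat_diag r h *\<^sub>v x) $ i = (\<Sum>j<r. (if i = j then h j else 0) * x $ j)"
    using assms by (simp add: mat_diag_def scalar_prod_def atLeast0LessThan)
  also have "\<dots> = (\<Sum>j<r. if i = j then h j * x $ j else 0)"
    by (intro sum.cong) auto
  finally have "(mat_diag r h *\<^sub>v x) $ i = (\<Sum>j<r. if i = j then h j * x $ j else 0)" .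
  thus ?thesis using assms by simp
qed

lemma mat_diag_mult_vec: "mat_diag r h *\<^sub>v x = vec r (\<lambda>i. h i * x $ i)" if "x \<in> carrier_vec r"
  using that by (intro eq_vecI) (simp_all add: mat_diag_mult_vec_index del: index_mult_mat_vec, simp add: mat_diag_def)

lemma norm2_mat_diag_le:
  assumes x: "x \<in> carrier_vec r" and h: "\<And>i. i < r \<Longrightarrow> \<bar>h i\<bar> \<le> C" and C: "0 \<le> C"
  shows "norm2 (mat_diag r h *\<^sub>v x) \<le> C * norm2 x"
proof -
  have "norm2 (mat_diag r h *\<^sub>v x) = L2_set (\<lambda>i. \<bar>h i * x $ i\<bar>) {..<r}"
    using x by (simp add: mat_diag_mult_vec norm2_L2_set L2_set_def)
  also have "\<dots> \<le> L2_set (\<lambda>i. C * \<bar>x $ i\<bar>) {..<r}"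
    using h by (intro L2_set_mono) (auto simp: abs_mult intro: mult_right_mono)
  also have "\<dots> = C * norm2 x"
    using x C by (simp add: norm2_L2_set L2_set_def power_mult_distrib sum_distrib_left[symmetric] real_sqrt_mult)
  finally show ?thesis .
qed

lemma norm2_mat_diag_ge:
  assumes x: "x \<in> carrier_vec r" and h: "\<And>i. i < r \<Longrightarrow> c \<le> h i" and c: "0 \<le> c"
  shows "c * norm2 x \<le> norm2 (mat_diag r h *\<^sub>v x)"
proof -
  have "c * norm2 x = L2_set (\<lambda>i. c * \<bar>x $ i\<bar>) {..<r}"
    using x c by (simp add: norm2_L2_set L2_set_def power_mult_distrib sum_distrib_left[symmetric] real_sqrt_mult)
  also have "\<dots> \<le> L2_set (\<lambda>i. \<bar>h i * x $ i\<bar>) {..<r}"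
    using h c by (intro L2_set_mono) (force simp: abs_mult intro!: mult_right_mono)+
  also have "\<dots> = norm2 (mat_diag r h *\<^sub>v x)"
    using x by (simp add: mat_diag_mult_vec norm2_L2_set L2_set_def)
  finally show ?thesis .
qed

text \<open>Padding an \<open>n \<times> r\<close> matrix with zero rows makes it square, and then a left inverse
  would be a right inverse.\<close>

lemma orthonormal_columns_le:
  fixes V :: "real mat"
  assumes V: "V \<in> carrier_mat n r" "V\<^sup>T * V = 1\<^sub>m r"
  shows "r \<le> n"
proof (rule ccontr)
  assume "\<not> r \<le> n"
  hence nr: "n < r" by simp
  define W where "W = mat r r (\<lambda>(i, j). if i < n then V $$ (i, j) else 0)"
  have W: "W \<in> carrier_mat r r" by (simp add: W_def)
  have "W\<^sup>T * W = 1\<^sub>m r"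
  proof (rule eq_matI)
    fix i j assume "i < dim_row (1\<^sub>m r :: real mat)" "j < dim_col (1\<^sub>m r :: real mat)"
    hence ij: "i < r" "j < r" by auto
    have "(W\<^sup>T * W) $$ (i, j) = (\<Sum>a<r. if a < n then V $$ (a, i) * V $$ (a, j) else 0)"
      using ij by (auto simp: W_def scalar_prod_def atLeast0LessThan intro!: sum.cong)
    also have "\<dots> = (\<Sum>a<n. V $$ (a, i) * V $$ (a, j))"
      using nr by (subst sum.inter_filter[symmetric]) (auto intro!: sum.cong)
    also have "\<dots> = (V\<^sup>T * V) $$ (i, j)"
      using ij V(1) by (auto simp: scalar_prod_def atLeast0LessThan intro!: sum.cong)
    finally show "(W\<^sup>T * W) $$ (i, j) = 1\<^sub>m r $$ (i, j)" by (simp add: V)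
  qed (auto simp: W_def)
  hence "W * W\<^sup>T = 1\<^sub>m r"
    using W by (intro mat_mult_left_right_inverse[of "W\<^sup>T"]) auto
  hence "(W * W\<^sup>T) $$ (n, n) = 1" using nr by simp
  moreover have "(W * W\<^sup>T) $$ (n, n) = 0"
    using nr by (simp add: W_def scalar_prod_def)
  ultimately show False by simp
qed

section \<open>Best uniform approximation from a finite-dimensional space\<close>

text \<open>Induction on the dimension: where the last function does not vanish, its coefficient can be
  read off from the value of the combination, once the others are modified to vanish there.\<close>

lemma pointwise_bounded_subsequence:
  fixes \<phi> :: "nat \<Rightarrow> 'a \<Rightarrow> complex" and c :: "nat \<Rightarrow> nat \<Rightarrow> complex"
  assumes "\<And>z. z \<in> I \<Longrightarrow> Bseq (\<lambda>n. \<Sum>i<N. c n i * \<phi> i z)"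
  shows "\<exists>c' r. strict_mono r \<and>
           (\<forall>z\<in>I. (\<lambda>n. \<Sum>i<N. c (r n) i * \<phi> i z) \<longlonglongrightarrow> (\<Sum>i<N. c' i * \<phi> i z))"
  using assms
proof (induction N arbitrary: \<phi> c)
  case 0
  show ?case by (intro exI[of _ undefined] exI[of _ id]) (auto simp: strict_mono_def)
next
  case (Suc N)
  show ?case
  proof (cases "\<forall>z\<in>I. \<phi> N z = 0")
    case True
    with Suc.prems have "\<And>z. z \<in> I \<Longrightarrow> Bseq (\<lambda>n. \<Sum>i<N. c n i * \<phi> i z)" by simp
    from Suc.IH[OF this] True show ?thesis by simp
  next
    case False
    then obtain z0 where z0: "z0 \<in> I" "\<phi> N z0 \<noteq> 0" by auto
    define a where "a i = \<phi> i z0 / \<phi> N z0" for i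
    define \<psi> where "\<psi> i z = \<phi> i z - a i * \<phi> N z" for i z
    define h where "h n z = (\<Sum>i<Suc N. c n i * \<phi> i z)" for n z
    \<comment> \<open>The coefficient of \<open>\<phi> N\<close> once the combination is rewritten
      in the \<open>\<psi> i\<close> and \<open>\<phi> N\<close>. Being a value of a bounded
      sequence over a nonzero constant, it is bounded, and Bolzano-Weierstrass applies.\<close>
    define t where "t n = h n z0 / \<phi> N z0" for n
    have t: "t n = (\<Sum>i<N. c n i * a i) + c n N" for n
      using z0 by (simp add: t_def h_def a_def sum_divide_distrib add_divide_distrib)
    have split: "(\<Sum>i<N. c n i * \<psi> i z) = h n z - t n * \<phi> N z" for n z
      unfolding t by (simp add: h_def \<psi>_def right_diff_distrib sum_subtractf sum_distrib_right
          distrib_right mult.assoc)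
    have bh: "Bseq (\<lambda>n. h n z)" if "z \<in> I" for z
      using Suc.prems[OF that] by (simp add: h_def)
    have "Bseq t"
      using bh[OF z0(1)] z0(2)
      by (simp add: t_def[abs_def] divide_inverse mult.commute[of _ "inverse _"] Bseq_cmult_iff)
    then obtain K where "\<And>n. cmod (t n) \<le> K" by (metis BseqE)
    then obtain r0 T where r0: "strict_mono r0" "(\<lambda>n. t (r0 n)) \<longlonglongrightarrow> T"
      using Bolzano_Weierstrass_complex_disc[of t K] unfolding LIMSEQ_iff by blast
    have "Bseq (\<lambda>n. \<Sum>i<N. c (r0 n) i * \<psi> i z)" if z: "z \<in> I" for z
    proof -
      obtain K L where "\<And>n. cmod (h n z) \<le> K" "\<And>n. cmod (t n) \<le> L"
        using bh[OF z] \<open>Bseq t\<close> by (metis BseqE)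
      hence "cmod (h n z - t n * \<phi> N z) \<le> K + L * cmod (\<phi> N z)" for n
        by (intro norm_triangle_le_diff add_mono) (auto simp: norm_mult intro: mult_right_mono)
      hence "Bseq (\<lambda>n. h n z - t n * \<phi> N z)" by (rule BseqI')
      from Bseq_subseq[OF this, of r0] show ?thesis by (simp add: split)
    qed
    from Suc.IH[of "\<lambda>n. c (r0 n)" \<psi>, OF this] obtain c' r1 where r1: "strict_mono r1"
      "\<And>z. z \<in> I \<Longrightarrow> (\<lambda>n. \<Sum>i<N. c (r0 (r1 n)) i * \<psi> i z) \<longlonglongrightarrow> (\<Sum>i<N. c' i * \<psi> i z)"
      by auto
    \<comment> \<open>Undoes the change of basis: expanding \<open>\<psi> i\<close> moves the sum of
      the \<open>c' i * a i\<close> into the last coefficient.\<close>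
    define d where "d i = (if i = N then T - (\<Sum>i<N. c' i * a i) else c' i)" for i
    have "(\<lambda>n. h (r0 (r1 n)) z) \<longlonglongrightarrow> (\<Sum>i<Suc N. d i * \<phi> i z)" if z: "z \<in> I" for z
    proof -
      have "(\<lambda>n. (\<Sum>i<N. c (r0 (r1 n)) i * \<psi> i z) + t (r0 (r1 n)) * \<phi> N z)
              \<longlonglongrightarrow> (\<Sum>i<N. c' i * \<psi> i z) + T * \<phi> N z"
        using r1(2)[OF z] LIMSEQ_subseq_LIMSEQ[OF r0(2) r1(1)]
        by (intro tendsto_add tendsto_mult tendsto_const) (auto simp: o_def)
      moreover have "(\<Sum>i<N. c' i * \<psi> i z) + T * \<phi> N z = (\<Sum>i<Suc N. d i * \<phi> i z)"
        by (simp add: d_def \<psi>_def right_diff_distrib sum_subtractf sum_distrib_right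
            left_diff_distrib mult.assoc)
      ultimately show ?thesis by (simp add: split)
    qed
    thus ?thesis using r0(1) r1(1)
      by (intro exI[of _ d] exI[of _ "r0 \<circ> r1"]) (auto simp: h_def strict_mono_def)
  qed
qed

text \<open>A minimizing sequence has a pointwise convergent subsequence. Pointwise convergence is
  enough, as the supremum is lower semicontinuous under it: each single deviation of the limit is a
  limit of deviations bounded by the suprema. If every error is infinite, any coefficients
  minimize.\<close>

lemma best_uniform_approximation_exists:
  fixes \<phi> :: "nat \<Rightarrow> 'a \<Rightarrow> complex" and g :: "'a \<Rightarrow> complex" and I :: "'a set" and N :: nat
  defines "E \<equiv> \<lambda>c. SUP z\<in>I. ennreal (cmod (g z - (\<Sum>i<N. c i * \<phi> i z)))"
  shows "\<exists>c. \<forall>c'. E c \<le> E c'"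
proof (cases "\<exists>c. E c < \<infinity>")
  case False
  thus ?thesis by (auto simp: not_less top_unique)
next
  case True
  obtain e where e: "range e \<subseteq> range E" "decseq e" "Inf (range E) = (INF n. e n)"
    using ennreal_Inf_countable_INF[of "range E"] by auto
  have "\<exists>c. \<forall>n. e n = E (c n)" using e(1) by (intro choice) auto
  then obtain c where c: "\<And>n. e n = E (c n)" by auto
  have lim: "(\<lambda>n. E (c n)) \<longlonglongrightarrow> Inf (range E)"
    using LIMSEQ_INF[OF e(2)] by (simp add: e(3) c[symmetric])
  have "Inf (range E) < \<infinity>" using True by (metis INF_lower UNIV_I order_le_less_trans)
  with lim have "eventually (\<lambda>n. E (c n) < \<infinity>) sequentially"
    by (rule order_tendstoD)
  \<comment> \<open>Early members of the minimizing sequence may have infinite error; from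
    \<open>n0\<close> on, monotonicity bounds all of them by the finite \<open>M\<close>.\<close>
  then obtain n0 where n0: "E (c n0) < \<infinity>" by (auto simp: eventually_sequentially)
  then obtain M where M: "E (c n0) = ennreal M" "0 \<le> M" by (cases "E (c n0)") auto
  have le: "cmod (g z - (\<Sum>i<N. c (n + n0) i * \<phi> i z)) \<le> M" if "z \<in> I" for z n
  proof -
    have "ennreal (cmod (g z - (\<Sum>i<N. c (n + n0) i * \<phi> i z))) \<le> E (c (n + n0))"
      unfolding E_def using that by (rule SUP_upper)
    also have "\<dots> \<le> E (c n0)" using e(2) by (simp add: c[symmetric] decseq_def)
    finally show ?thesis using M by simp
  qed
  have "Bseq (\<lambda>n. \<Sum>i<N. c (n + n0) i * \<phi> i z)" if "z \<in> I" for z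
  proof (rule BseqI')
    fix n
    have "cmod (\<Sum>i<N. c (n + n0) i * \<phi> i z) \<le>
        cmod (g z) + cmod (g z - (\<Sum>i<N. c (n + n0) i * \<phi> i z))"
      using norm_triangle_ineq4[of "g z" "g z - (\<Sum>i<N. c (n + n0) i * \<phi> i z)"] by simp
    thus "cmod (\<Sum>i<N. c (n + n0) i * \<phi> i z) \<le> cmod (g z) + M"
      using le[OF that, of n] by simp
  qed
  from pointwise_bounded_subsequence[where c = "\<lambda>n. c (n + n0)" and \<phi> = \<phi> and I = I and N = N, OF this] obtain d r where r: "strict_mono r" and
    d: "\<And>z. z \<in> I \<Longrightarrow> (\<lambda>n. \<Sum>i<N. c (r n + n0) i * \<phi> i z) \<longlonglongrightarrow> (\<Sum>i<N. d i * \<phi> i z)"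
    by auto
  have lim': "(\<lambda>n. E (c (r n + n0))) \<longlonglongrightarrow> Inf (range E)"
    using LIMSEQ_subseq_LIMSEQ[OF LIMSEQ_ignore_initial_segment[OF lim, of n0] r] by (simp add: o_def)
  have "E d \<le> Inf (range E)"
  proof (subst E_def, rule SUP_least)
    fix z assume z: "z \<in> I"
    have t1: "(\<lambda>n. ennreal (cmod (g z - (\<Sum>i<N. c (r n + n0) i * \<phi> i z))))
            \<longlonglongrightarrow> ennreal (cmod (g z - (\<Sum>i<N. d i * \<phi> i z)))"
      by (intro tendsto_ennrealI tendsto_intros d z)
    have t2: "ennreal (cmod (g z - (\<Sum>i<N. c (r n + n0) i * \<phi> i z))) \<le> E (c (r n + n0))" for n
      unfolding E_def using z by (rule SUP_upper)
    show "ennreal (cmod (g z - (\<Sum>i<N. d i * \<phi> i z))) \<le> Inf (range E)"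
      by (rule LIMSEQ_le[OF t1 lim']) (use t2 in blast)
  qed
  thus ?thesis by (metis INF_lower UNIV_I order_trans)
qed

section \<open>Polynomials in a matrix\<close>

lemma poly_mat_carrier [simp]: "M \<in> carrier_mat n n \<Longrightarrow> poly_mat p M \<in> carrier_mat n n"
  by (simp add: poly_mat_def)

text \<open>A bound \<open>N\<close> instead of the exact degree lets polynomials of different
  degrees share one range of summation, also when a degree drops under addition.\<close>

lemma poly_mat_index:
  assumes "M \<in> carrier_mat n n" "i < n" "j < n" "degree p \<le> N"
  shows "poly_mat p M $$ (i, j) = (\<Sum>d\<le>N. coeff p d * (M ^\<^sub>m d) $$ (i, j))"
proof -
  have "(\<Sum>d\<le>N. coeff p d * (M ^\<^sub>m d) $$ (i, j)) = (\<Sum>d\<le>degree p. coeff p d * (M ^\<^sub>m d) $$ (i, j))"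
    using assms(4) by (intro sum.mono_neutral_right) (auto simp: coeff_eq_0)
  thus ?thesis using assms by (simp add: poly_mat_def)
qed

lemma poly_mat_0 [simp]: "M \<in> carrier_mat n n \<Longrightarrow> poly_mat 0 M = 0\<^sub>m n n"
  by (intro eq_matI) (auto simp: poly_mat_def)

text \<open>The Horner recursion, which opens \<open>poly_mat\<close> to induction on the
  polynomial; multiplicativity, intertwining and evaluation at diagonal matrices all rest on
  it.\<close>

lemma poly_mat_pCons:
  assumes M: "M \<in> carrier_mat n n"
  shows "poly_mat (pCons a p) M = a \<cdot>\<^sub>m 1\<^sub>m n + poly_mat p M * M"
proof (rule eq_matI)
  fix i j assume "i < dim_row (a \<cdot>\<^sub>m 1\<^sub>m n + poly_mat p M * M)" "j < dim_col (a \<cdot>\<^sub>m 1\<^sub>m n + poly_mat p M * M)"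
  hence ij: "i < n" "j < n" using M carrier_matD[OF poly_mat_carrier[OF M, of p]] by auto
  have pw: "(M ^\<^sub>m Suc d) $$ (i, j) = (\<Sum>l<n. (M ^\<^sub>m d) $$ (i, l) * M $$ (l, j))" for d
    using ij M by (auto simp: scalar_prod_def atLeast0LessThan intro!: sum.cong)
  have "poly_mat (pCons a p) M $$ (i, j) =
      (\<Sum>d\<le>Suc (degree p). coeff (pCons a p) d * (M ^\<^sub>m d) $$ (i, j))"
    by (rule poly_mat_index[OF M ij]) (rule degree_pCons_le)
  also have "\<dots> = a * (M ^\<^sub>m 0) $$ (i, j) + (\<Sum>d\<le>degree p. coeff p d * (M ^\<^sub>m Suc d) $$ (i, j))"
    by (subst sum.atMost_Suc_shift) simp
  also have "(\<Sum>d\<le>degree p. coeff p d * (M ^\<^sub>m Suc d) $$ (i, j)) =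
      (\<Sum>l<n. \<Sum>d\<le>degree p. coeff p d * ((M ^\<^sub>m d) $$ (i, l) * M $$ (l, j)))"
    unfolding pw sum_distrib_left by (rule sum.swap)
  also have "\<dots> = (\<Sum>l<n. poly_mat p M $$ (i, l) * M $$ (l, j))"
    using ij by (intro sum.cong)
      (simp_all add: poly_mat_index[OF M _ _ order_refl] sum_distrib_right mult.assoc)
  also have "\<dots> = (poly_mat p M * M) $$ (i, j)"
    using ij M carrier_matD[OF poly_mat_carrier[OF M, of p]]
    by (auto simp: scalar_prod_def atLeast0LessThan intro!: sum.cong)
  finally show "poly_mat (pCons a p) M $$ (i, j) = (a \<cdot>\<^sub>m 1\<^sub>m n + poly_mat p M * M) $$ (i, j)"
    using ij M carrier_matD[OF poly_mat_carrier[OF M, of p]] by simp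
qed (use M in \<open>simp_all add: poly_mat_def\<close>)

lemma poly_mat_add:
  assumes M: "M \<in> carrier_mat n n"
  shows "poly_mat (p + q) M = poly_mat p M + poly_mat q M"
proof (rule eq_matI)
  fix i j assume "i < dim_row (poly_mat p M + poly_mat q M)" "j < dim_col (poly_mat p M + poly_mat q M)"
  hence ij: "i < n" "j < n" using M by (auto simp: poly_mat_def)
  define N where "N = max (degree p) (degree q)"
  have "degree (p + q) \<le> N" "degree p \<le> N" "degree q \<le> N"
    by (auto simp: N_def intro: degree_add_le)
  note ix = this[THEN poly_mat_index[OF M ij]]
  have "poly_mat (p + q) M $$ (i, j) = poly_mat p M $$ (i, j) + poly_mat q M $$ (i, j)"
    unfolding ix by (simp add: distrib_right sum.distrib)
  thus "poly_mat (p + q) M $$ (i, j) = (poly_mat p M + poly_mat q M) $$ (i, j)"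
    using ij M by (simp add: poly_mat_def)
qed (use M in \<open>simp_all add: poly_mat_def\<close>)

lemma poly_mat_smult:
  assumes M: "M \<in> carrier_mat n n"
  shows "poly_mat (Polynomial.smult a p) M = a \<cdot>\<^sub>m poly_mat p M"
proof (rule eq_matI)
  fix i j assume "i < dim_row (a \<cdot>\<^sub>m poly_mat p M)" "j < dim_col (a \<cdot>\<^sub>m poly_mat p M)"
  hence ij: "i < n" "j < n" using M by (auto simp: poly_mat_def)
  have "poly_mat (Polynomial.smult a p) M $$ (i, j) = a * poly_mat p M $$ (i, j)"
    unfolding poly_mat_index[OF M ij degree_smult_le[of a p]] poly_mat_index[OF M ij order_refl[of "degree p"]]
    by (simp add: sum_distrib_left mult.assoc)
  thus "poly_mat (Polynomial.smult a p) M $$ (i, j) = (a \<cdot>\<^sub>m poly_mat p M) $$ (i, j)"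
    using ij M by (simp add: poly_mat_def)
qed (use M in \<open>simp_all add: poly_mat_def\<close>)

text \<open>Serves several ends: \<open>A\<close> carries \<open>A\<^sup>T * A\<close> into
  \<open>A * A\<^sup>T\<close>, \<open>V\<^sup>T\<close> carries \<open>A\<^sup>T * A\<close> into a
  diagonal matrix, and with equal matrices it says that whatever commutes with \<open>M\<close>
  commutes with every polynomial in \<open>M\<close>.\<close>

lemma poly_mat_intertwine:
  assumes A: "A \<in> carrier_mat m n" and M: "M \<in> carrier_mat n n" and N: "N \<in> carrier_mat m m"
    and AM: "A * M = N * A"
  shows "A * poly_mat p M = poly_mat p N * A"
proof (induction p)
  case 0
  show ?case using A M N by simp
next
  case (pCons a p)
  have pM: "poly_mat p M \<in> carrier_mat n n" and pN: "poly_mat p N \<in> carrier_mat m m"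
    using M N by auto
  have "A * poly_mat (pCons a p) M = A * (a \<cdot>\<^sub>m 1\<^sub>m n) + A * (poly_mat p M * M)"
    unfolding poly_mat_pCons[OF M] using A M mult_carrier_mat[OF pM M] by (intro mult_add_distrib_mat) auto
  also have "A * (poly_mat p M * M) = poly_mat p N * A * M"
    using A M pM by (simp add: pCons.IH assoc_mult_mat[symmetric, of A m n _ n _ n])
  also have "\<dots> = poly_mat p N * N * A"
    using A M N pN by (simp add: AM assoc_mult_mat[of _ m m _ n _ n] assoc_mult_mat[of _ m m _ m _ n])
  also have "A * (a \<cdot>\<^sub>m 1\<^sub>m n) = (a \<cdot>\<^sub>m 1\<^sub>m m) * A"
    using A by (simp add: mult_smult_distrib[of A m n _ n] mult_smult_assoc_mat[of _ m m])
  also have "(a \<cdot>\<^sub>m 1\<^sub>m m) * A + poly_mat p N * N * A = poly_mat (pCons a p) N * A"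
    unfolding poly_mat_pCons[OF N] using A N pN mult_carrier_mat[OF pN N]
    by (intro add_mult_distrib_mat[symmetric, of _ m m]) auto
  finally show ?case .
qed

lemma poly_mat_commute: "M \<in> carrier_mat n n \<Longrightarrow> M * poly_mat p M = poly_mat p M * M"
  by (rule poly_mat_intertwine) auto

lemma smult_mat_0: "0 \<cdot>\<^sub>m 1\<^sub>m n = (0\<^sub>m n n :: 'a :: comm_ring_1 mat)"
  by (intro eq_matI) auto

lemma poly_mat_mult:
  assumes M: "M \<in> carrier_mat n n"
  shows "poly_mat (p * q) M = poly_mat p M * poly_mat q M"
proof (induction p)
  case 0
  show ?case using M left_mult_zero_mat[OF poly_mat_carrier[OF M]] by simp
next
  case (pCons a p)
  have C: "poly_mat p M \<in> carrier_mat n n" "poly_mat q M \<in> carrier_mat n n" using M by auto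
  have "poly_mat (pCons a p * q) M = a \<cdot>\<^sub>m poly_mat q M + (0 \<cdot>\<^sub>m 1\<^sub>m n + poly_mat p M * poly_mat q M * M)"
    by (simp add: mult_pCons_left poly_mat_add[OF M] poly_mat_smult[OF M] poly_mat_pCons[OF M] pCons.IH)
  also have "0 \<cdot>\<^sub>m 1\<^sub>m n + poly_mat p M * poly_mat q M * M = poly_mat p M * poly_mat q M * M"
    using left_add_zero_mat[OF mult_carrier_mat[OF mult_carrier_mat[OF C] M]]
    by (simp add: smult_mat_0)
  also have "\<dots> = poly_mat p M * M * poly_mat q M"
    using assoc_mult_mat[OF C M] assoc_mult_mat[OF C(1) M C(2)] poly_mat_commute[OF M, of q] by simp
  also have "a \<cdot>\<^sub>m poly_mat q M + \<dots> = poly_mat (pCons a p) M * poly_mat q M"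
    unfolding poly_mat_pCons[OF M] using M C mult_carrier_mat[OF C(1) M]
    add_mult_distrib_mat[of "a \<cdot>\<^sub>m 1\<^sub>m n" n n "poly_mat p M * M" "poly_mat q M" n]
    by (simp add: mult_smult_assoc_mat[of "1\<^sub>m n" n n "poly_mat q M" n] left_mult_one_mat[OF C(2)])
  finally show ?case .
qed

lemma poly_mat_1 [simp]:
  assumes M: "M \<in> carrier_mat n n"
  shows "poly_mat 1 M = 1\<^sub>m n"
proof -
  have "poly_mat (pCons 1 0) M = 1\<^sub>m n"
    using M by (subst poly_mat_pCons[OF M]) (auto intro!: eq_matI)
  thus ?thesis by (simp add: one_pCons)
qed

lemma poly_mat_linear:
  assumes M: "M \<in> carrier_mat n n"
  shows "poly_mat [:- c, 1:] M = char_matrix M c"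
proof -
  have "poly_mat [:- c, 1:] M = (- c) \<cdot>\<^sub>m 1\<^sub>m n + M"
    using M poly_mat_1[OF M] by (simp add: poly_mat_pCons[OF M, of "- c"] one_pCons)
  thus ?thesis using M by (intro eq_matI) (auto simp: char_matrix_def)
qed

lemma poly_mat_mat_diag:
  "poly_mat p (mat_diag r h) = mat_diag r (\<lambda>i. poly p (h i))" for h :: "nat \<Rightarrow> 'a :: comm_ring_1"
proof (induction p)
  case 0
  show ?case by (subst poly_mat_0[of _ r]) (auto intro!: eq_matI simp: mat_diag_def)
next
  case (pCons a p)
  show ?case unfolding poly_mat_pCons[OF mat_diag_dim] pCons.IH mat_diag_diag
    by (intro eq_matI) (auto simp: mat_diag_def mult.commute)
qed

lemma smult_mat_mult_vec:
  fixes a :: "'a :: comm_ring_1"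
  assumes "M \<in> carrier_mat m n" "x \<in> carrier_vec n"
  shows "(a \<cdot>\<^sub>m M) *\<^sub>v x = a \<cdot>\<^sub>v (M *\<^sub>v x)"
  using assms by (intro eq_vecI) simp_all

lemma poly_mat_monom_mult_vec:
  assumes M: "M \<in> carrier_mat n n" and x: "x \<in> carrier_vec n"
  shows "poly_mat (monom a i) M *\<^sub>v x = a \<cdot>\<^sub>v ((M ^\<^sub>m i) *\<^sub>v x)"
proof -
  have "poly_mat (monom a i) M = a \<cdot>\<^sub>m (M ^\<^sub>m i)"
  proof (rule eq_matI)
    fix r s assume "r < dim_row (a \<cdot>\<^sub>m (M ^\<^sub>m i))" "s < dim_col (a \<cdot>\<^sub>m (M ^\<^sub>m i))"
    hence rs: "r < n" "s < n" using carrier_matD[OF pow_carrier_mat[OF M, of i]] by simp_all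
    have "poly_mat (monom a i) M $$ (r, s) = (\<Sum>d\<le>i. (if d = i then a * (M ^\<^sub>m d) $$ (r, s) else 0))"
      unfolding poly_mat_index[OF M rs degree_monom_le] by (intro sum.cong) auto
    thus "poly_mat (monom a i) M $$ (r, s) = (a \<cdot>\<^sub>m (M ^\<^sub>m i)) $$ (r, s)"
      using rs M by simp
  qed (use M in \<open>simp_all add: poly_mat_def\<close>)
  thus ?thesis using smult_mat_mult_vec[OF pow_carrier_mat[OF M] x] by simp
qed

section \<open>Invertibility of the denominator polynomial at a matrix\<close>

lemma det_poly_mat_prod_linear:
  fixes M :: "'a :: field mat"
  assumes M: "M \<in> carrier_mat n n" and "finite J"
    and "\<And>j c. j \<in> J \<Longrightarrow> \<xi> j = Some c \<Longrightarrow> \<not> eigenvalue M c"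
  shows "det (poly_mat (\<Prod>j\<in>J. case \<xi> j of None \<Rightarrow> 1 | Some c \<Rightarrow> [:- c, 1:]) M) \<noteq> 0"
  using assms(2,3)
proof (induction J)
  case empty
  show ?case using M by simp
next
  case (insert j J)
  let ?F = "\<lambda>j. case \<xi> j of None \<Rightarrow> 1 | Some c \<Rightarrow> [:- c, 1:]"
  have "det (poly_mat (?F j) M) \<noteq> 0"
    using insert.prems[of j] M
    by (cases "\<xi> j") (simp_all add: poly_mat_linear eigenvalue_det)
  moreover have "det (poly_mat (prod ?F J) M) \<noteq> 0"
    using insert.prems by (intro insert.IH) auto
  ultimately show ?case
    using insert.hyps M by (simp add: poly_mat_mult[OF M] det_mult[of _ n])
qed

text \<open>Justifies the application of \<open>the\<close> in \<open>rat_krylov\<close>: each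
  linear factor is a characteristic matrix at a number that is no eigenvalue, hence has nonzero
  determinant.\<close>

lemma mat_inverse_pole_poly:
  assumes M: "M \<in> carrier_mat n n"
    and "\<And>j c. 1 \<le> j \<Longrightarrow> j \<le> k - 1 \<Longrightarrow> \<xi> j = Some c \<Longrightarrow> \<not> eigenvalue M c"
    and G: "G = the (mat_inverse (poly_mat (pole_poly \<xi> k) M))"
  shows "G \<in> carrier_mat n n" "poly_mat (pole_poly \<xi> k) M * G = 1\<^sub>m n"
    "G * poly_mat (pole_poly \<xi> k) M = 1\<^sub>m n"
proof -
  let ?X = "poly_mat (pole_poly \<xi> k) M"
  have X: "?X \<in> carrier_mat n n" using M by simp
  have "det ?X \<noteq> 0"
    unfolding pole_poly_def using assms(2) by (intro det_poly_mat_prod_linear[OF M]) auto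
  \<comment> \<open>The argument \<open>b\<close> only fills the record extension of
    \<open>ring_mat\<close>, whose units are the invertible matrices.\<close>
  hence "mat_inverse ?X \<noteq> None"
    using mat_inverse(1)[OF X, where b = "()"] det_non_zero_imp_unit[OF X, where b = "()"] by blast
  then obtain B where "mat_inverse ?X = Some B" by auto
  with mat_inverse(2)[OF X this] G show "G \<in> carrier_mat n n" "?X * G = 1\<^sub>m n" "G * ?X = 1\<^sub>m n"
    by auto
qed

section \<open>Existence of a best rational approximation\<close>

text \<open>The reduced fraction satisfies \<open>p1 * e = p * q1\<close>. If \<open>q1\<close>
  vanished at \<open>w\<close>, then so would \<open>p1\<close>, against coprimality. The common
  factor \<open>d\<close> may vanish at \<open>w\<close>, and \<open>p\<close> and \<open>e\<close>
  may share further factors.\<close>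

lemma ratfun_val_cancel:
  assumes q: "d * e \<noteq> 0" and w: "poly e w \<noteq> 0"
  shows "ratfun_val (d * p) (d * e) w = Some (poly p w / poly e w)"
proof -
  define g where "g = gcd (d * p) (d * e)"
  define p1 where "p1 = d * p div g"
  define q1 where "q1 = d * e div g"
  have "g \<noteq> 0" using q by (auto simp: g_def)
  have p1: "d * p = g * p1" and q1: "d * e = g * q1"
    by (simp_all add: p1_def q1_def g_def)
  have "coprime p1 q1"
    unfolding p1_def q1_def g_def using q by (intro div_gcd_coprime) auto
  have "g * d * (p1 * e) = (g * p1) * (d * e)" by (simp add: ac_simps)
  also have "\<dots> = (d * p) * (g * q1)" by (simp only: p1 q1)
  also have "\<dots> = g * d * (p * q1)" by (simp add: ac_simps)
  finally have "g * d * (p1 * e) = g * d * (p * q1)" .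
  hence eq: "p1 * e = p * q1" using q \<open>g \<noteq> 0\<close> by simp
  have q1w: "poly q1 w \<noteq> 0"
  proof
    assume 0: "poly q1 w = 0"
    hence "poly p1 w * poly e w = 0" using arg_cong[OF eq, of "\<lambda>f. poly f w"] by simp
    hence "[:- w, 1:] dvd p1" "[:- w, 1:] dvd q1" using w 0 by (simp_all add: poly_eq_0_iff_dvd)
    with \<open>coprime p1 q1\<close> have "is_unit [:- w, 1:]" by (rule coprime_common_divisor)
    thus False by simp
  qed
  have "poly p1 w * poly e w = poly p w * poly q1 w"
    using arg_cong[OF eq, of "\<lambda>f. poly f w"] by simp
  hence "poly p1 w / poly q1 w = poly p w / poly e w"
    using w q1w by (simp add: field_simps)
  thus ?thesis
    using q1w unfolding ratfun_val_def Let_def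
    by (simp add: p1_def[symmetric] q1_def[symmetric] g_def[symmetric])
qed

text \<open>A common divisor divides the remainder of \<open>p\<close> modulo the linear factor,
  which is the nonzero constant \<open>poly p c\<close>.\<close>

lemma coprime_linear_poly:
  fixes p :: "complex poly"
  assumes "poly p c \<noteq> 0"
  shows "coprime [:- c, 1:] p"
proof (rule coprimeI)
  fix h assume "h dvd [:- c, 1:]" "h dvd p"
  hence "h dvd p - [:- c, 1:] * synthetic_div p c" by (intro dvd_diff dvd_mult2)
  also have "p - [:- c, 1:] * synthetic_div p c = [:poly p c:]"
    using synthetic_div_correct'[of c p] by (simp add: algebra_simps)
  finally show "is_unit h" using assms by (metis dvd_trans is_unit_const_poly_iff dvd_field_iff)
qed

text \<open>All roots of the product lie in \<open>W\<close>, where the reduced denominator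
  \<open>q1\<close> has no root, so the product is coprime to \<open>q1\<close>. It divides
  \<open>p * q1\<close> and therefore \<open>p\<close>. Treating the product as a whole takes care
  of repeated poles.\<close>

lemma ratfun_val_no_pole_imp_dvd:
  assumes q: "prod (\<lambda>j. [:- c j, 1:]) J * e \<noteq> 0" and c: "\<And>j. j \<in> J \<Longrightarrow> c j \<in> W"
    and W: "\<And>w. w \<in> W \<Longrightarrow> ratfun_val p (prod (\<lambda>j. [:- c j, 1:]) J * e) w \<noteq> None"
  shows "prod (\<lambda>j. [:- c j, 1:]) J dvd p"
proof -
  let ?d = "prod (\<lambda>j. [:- c j, 1:]) J"
  define g where "g = gcd p (?d * e)"
  define p1 where "p1 = p div g"
  define q1 where "q1 = ?d * e div g"
  have p1: "p = g * p1" and q1: "?d * e = g * q1"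
    by (simp_all add: p1_def q1_def g_def)
  have "poly q1 w \<noteq> 0" if "w \<in> W" for w
    using W[OF that] by (auto simp: ratfun_val_def Let_def q1_def g_def split: if_splits)
  hence cop: "coprime ?d q1"
    using c by (intro prod_coprime_left coprime_linear_poly) auto
  have "?d dvd ?d * e * p1" by simp
  also have "?d * e * p1 = p * q1" unfolding q1 by (subst p1) (simp add: ac_simps)
  finally show ?thesis using cop by (simp add: coprime_dvd_mult_left_iff)
qed

text \<open>The numerators for which no pole remains on the interval are the multiples of the product \<open>d\<close>
  of those factors of the denominator that vanish there. For all others the error norm is infinite.\<close>

lemma best_rational_approximation_exists:
  fixes g w :: "real \<Rightarrow> complex" and I :: "real set"
    and \<xi> :: "nat \<Rightarrow> complex option" and k :: nat
  defines "E \<equiv> \<lambda>p. sup_norm I (\<lambda>z. map_option (\<lambda>y. g z - y * w z)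
      (ratfun_val p (pole_poly \<xi> k) (complex_of_real (z\<^sup>2))))"
  assumes k: "1 \<le> k"
  shows "\<exists>p. is_arg_min E (\<lambda>p. degree p \<le> k - 1) p"
proof -
  define W where "W = (\<lambda>z. complex_of_real (z\<^sup>2)) ` I"
  define c where "c j = the (\<xi> j)" for j
  \<comment> \<open>Collects the finite poles that are hit by \<open>z\<^sup>2\<close> for some
    \<open>z\<close> in \<open>I\<close>, which is why \<open>W\<close> consists of squares.\<close>
  define J where "J = {j \<in> {1..k - 1}. \<xi> j \<noteq> None \<and> c j \<in> W}"
  define d where "d = (\<Prod>j\<in>J. [:- c j, 1:])"
  define e where "e = (\<Prod>j\<in>{1..k - 1} - J. case \<xi> j of None \<Rightarrow> 1 | Some c \<Rightarrow> [:- c, 1:])"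
  have "(\<Prod>j\<in>J. case \<xi> j of None \<Rightarrow> 1 | Some c \<Rightarrow> [:- c, 1:]) = d"
    unfolding d_def by (intro prod.cong) (auto simp: J_def c_def)
  moreover have "J \<subseteq> {1..k - 1}" by (auto simp: J_def)
  ultimately have q: "pole_poly \<xi> k = d * e"
    unfolding pole_poly_def e_def by (subst prod.subset_diff[of J]) (auto simp: mult.commute)
  have d0: "d \<noteq> 0" by (auto simp: d_def J_def)
  have "(case \<xi> j of None \<Rightarrow> 1 | Some c \<Rightarrow> [:- c, 1:]) \<noteq> 0" for j by (cases "\<xi> j") simp_all
  hence q0: "d * e \<noteq> 0" using d0 by (simp add: e_def)
  have "poly (case \<xi> j of None \<Rightarrow> 1 | Some c \<Rightarrow> [:- c, 1:]) x \<noteq> 0" if "j \<in> {1..k - 1} - J" "x \<in> W" for j x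
    using that by (cases "\<xi> j") (auto simp: J_def c_def)
  hence ew: "poly e x \<noteq> 0" if "x \<in> W" for x
    using that by (simp add: e_def poly_prod)
  have degd: "degree d = card J"
    unfolding d_def by (subst degree_prod_eq_sum_degree) auto
  have "card J \<le> k - 1" using card_mono[OF _ \<open>J \<subseteq> {1..k - 1}\<close>] by simp
  \<comment> \<open>The number of free coefficients of the cofactor: of degree at most
    \<open>k - 1\<close>, \<open>card J\<close> is taken up by \<open>d\<close>.\<close>
  define N where "N = k - card J"
  have N: "N \<ge> 1" "N + card J = k" using \<open>card J \<le> k - 1\<close> k by (auto simp: N_def)
  \<comment> \<open>The approximating functions after \<open>d\<close> is cancelled;
    \<open>e\<close> has no root on \<open>W\<close>. The weight \<open>w\<close> lets one argument
    serve both norms, being \<open>z\<close> in one and 1 in the other.\<close>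
  define \<phi> where "\<phi> i z = complex_of_real (z\<^sup>2) ^ i * w z / poly e (complex_of_real (z\<^sup>2))" for i z
  have E_dvd: "E (d * p) = (SUP z\<in>I. ennreal (cmod (g z - (\<Sum>i<N. coeff p i * \<phi> i z))))"
    if "degree p < N" for p
    unfolding E_def sup_norm_def
  proof (intro SUP_cong refl)
    fix z assume z: "z \<in> I"
    let ?x = "complex_of_real (z\<^sup>2)"
    have "poly p ?x = (\<Sum>i<N. coeff p i * ?x ^ i)"
      unfolding poly_altdef using that by (intro sum.mono_neutral_left) (auto simp: coeff_eq_0)
    hence "poly p ?x / poly e ?x * w z = (\<Sum>i<N. coeff p i * \<phi> i z)"
      by (simp add: \<phi>_def sum_distrib_right sum_divide_distrib mult.assoc)
    moreover have "ratfun_val (d * p) (pole_poly \<xi> k) ?x = Some (poly p ?x / poly e ?x)"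
      unfolding q using z by (intro ratfun_val_cancel q0 ew) (auto simp: W_def)
    ultimately show "(case map_option (\<lambda>y. g z - y * w z) (ratfun_val (d * p) (pole_poly \<xi> k) ?x) of
        None \<Rightarrow> \<infinity> | Some y \<Rightarrow> ennreal (cmod y)) = ennreal (cmod (g z - (\<Sum>i<N. coeff p i * \<phi> i z)))"
      by simp
  qed
  obtain a where a: "\<And>a'. (SUP z\<in>I. ennreal (cmod (g z - (\<Sum>i<N. a i * \<phi> i z))))
      \<le> (SUP z\<in>I. ennreal (cmod (g z - (\<Sum>i<N. a' i * \<phi> i z))))"
    using best_uniform_approximation_exists[where I = I and g = g and N = N and \<phi> = \<phi>] by blast
  define p where "p = (\<Sum>i<N. monom (a i) i)"
  have cp: "coeff p i = a i" if "i < N" for i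
    using that by (simp add: p_def coeff_sum)
  have degp: "degree p < N"
    unfolding p_def using N(1) by (intro degree_sum_less) (auto intro: le_less_trans[OF degree_monom_le])
  have min: "E (d * p) \<le> E y" if y: "degree y \<le> k - 1" for y
  proof (cases "d dvd y")
    case True
    then obtain y' where y': "y = d * y'" by auto
    have "degree y' < N"
    proof (cases "y' = 0")
      case False
      hence "degree y = card J + degree y'" using d0 by (simp add: y' degree_mult_eq degd)
      thus ?thesis using y N k by linarith
    qed (use N in auto)
    moreover have "E (d * p) = (SUP z\<in>I. ennreal (cmod (g z - (\<Sum>i<N. a i * \<phi> i z))))"
      unfolding E_dvd[OF degp] by (simp add: cp)
    ultimately show ?thesis using a[of "coeff y'"] by (simp add: y' E_dvd)
  next
    case False
    have "\<exists>x\<in>W. ratfun_val y (d * e) x = None"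
    proof (rule ccontr)
      assume "\<not> ?thesis"
      hence "d dvd y"
        using ratfun_val_no_pole_imp_dvd[OF q0[unfolded d_def], of W y] by (force simp: d_def J_def)
      with False show False ..
    qed
    then obtain z where "z \<in> I" "ratfun_val y (d * e) (complex_of_real (z\<^sup>2)) = None"
      by (auto simp: W_def)
    hence "\<infinity> \<le> E y"
      unfolding E_def sup_norm_def q by (intro SUP_upper2[of z]) auto
    thus ?thesis by (simp add: top_unique)
  qed
  have "degree (d * p) \<le> k - 1"
    using degree_mult_le[of d p] degp degd N by linarith
  with min show ?thesis
    by (intro exI[of _ "d * p"]) (auto simp: is_arg_min_def not_less)
qed

section \<open>Existence of the compact singular value decomposition\<close>

lemma trace_mult_commute:
  fixes X Y :: "'a :: comm_ring_1 mat"
  assumes "X \<in> carrier_mat n n" "Y \<in> carrier_mat n n"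
  shows "(\<Sum>i<n. (X * Y) $$ (i, i)) = (\<Sum>i<n. (Y * X) $$ (i, i))"
proof -
  have "(\<Sum>i<n. (X * Y) $$ (i, i)) = (\<Sum>i<n. \<Sum>j<n. X $$ (i, j) * Y $$ (j, i))"
    using assms by (intro sum.cong) (simp_all add: scalar_prod_def atLeast0LessThan)
  also have "\<dots> = (\<Sum>j<n. \<Sum>i<n. Y $$ (j, i) * X $$ (i, j))"
    by (subst sum.swap) (simp add: mult.commute)
  also have "\<dots> = (\<Sum>i<n. (Y * X) $$ (i, i))"
    using assms by (intro sum.cong) (simp_all add: scalar_prod_def atLeast0LessThan)
  finally show ?thesis .
qed

text \<open>If all eigenvalues vanish, the Schur form is strictly upper triangular, so the trace of
  \<open>T * T\<close>, which is the sum of the squared entries of \<open>T\<close>, is zero.\<close>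

lemma symmetric_nonzero_eigenvalue:
  fixes T :: "real mat"
  assumes T: "T \<in> carrier_mat n n" "T\<^sup>T = T" "T \<noteq> 0\<^sub>m n n"
  shows "\<exists>\<mu>. eigenvalue (cmat T) \<mu> \<and> \<mu> \<noteq> 0"
proof (rule ccontr)
  assume no: "\<not> ?thesis"
  have Tc: "cmat T \<in> carrier_mat n n" using T by simp
  obtain es where es: "char_poly (cmat T) = (\<Prod>a\<leftarrow>es. [:- a, 1:])"
    using char_poly_factorized[OF Tc] by auto
  obtain B where B: "B \<in> carrier_mat n n" "upper_triangular B" "similar_mat (cmat T) B"
    using schur_decomposition_exists[OF Tc es] by auto
  then obtain P Q where "similar_mat_wit (cmat T) B P Q" by (auto simp: similar_mat_def)
  note wit = similar_mat_witD2[OF Tc this]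
  have diag: "B $$ (i, i) = 0" if i: "i < n" for i
  proof -
    have "char_poly (cmat T) = (\<Prod>a\<leftarrow>diag_mat B. [:- a, 1:])"
      using char_poly_similar[OF B(3)] char_poly_upper_triangular[OF B(1,2)] by simp
    moreover have "B $$ (i, i) \<in> set (diag_mat B)" using i B(1) by (auto simp: diag_mat_def)
    ultimately have "poly (char_poly (cmat T)) (B $$ (i, i)) = 0"
      by (simp add: poly_prod_list)
    thus ?thesis using no eigenvalue_root_char_poly[OF Tc] by blast
  qed
  have "(\<Sum>i<n. (cmat T * cmat T) $$ (i, i)) = (\<Sum>i<n. (P * (B * B * Q)) $$ (i, i))"
  proof -
    have "cmat T * cmat T = P * B * Q * (P * B * Q)" using wit(3) by simp
    also have "\<dots> = P * B * (Q * P) * (B * Q)"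
      using wit(4-7) by (simp add: assoc_mult_mat[of _ n n _ n _ n])
    also have "\<dots> = P * (B * B * Q)"
      unfolding wit(2) using wit(4-7) by (simp add: assoc_mult_mat[of _ n n _ n _ n])
    finally show ?thesis by simp
  qed
  also have "\<dots> = (\<Sum>i<n. (B * B * Q * P) $$ (i, i))"
    using wit by (intro trace_mult_commute) auto
  also have "B * B * Q * P = B * B"
    using wit(2,4-7) by (simp add: assoc_mult_mat[of _ n n _ n _ n])
  also have "(\<Sum>i<n. (B * B) $$ (i, i)) = 0"
  proof (intro sum.neutral ballI)
    fix i assume "i \<in> {..<n}"
    hence i: "i < n" by simp
    have "B $$ (i, j) * B $$ (j, i) = 0" if "j < n" for j
      using diag[OF i] B(1,2) i that unfolding upper_triangular_def
      by (cases i j rule: linorder_cases) auto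
    thus "(B * B) $$ (i, i) = 0" using i B(1) by (simp add: scalar_prod_def sum.neutral)
  qed
  finally have 0: "(\<Sum>i<n. (cmat T * cmat T) $$ (i, i)) = 0" .
  have Tsym: "T $$ (j, i) = T $$ (i, j)" if "i < n" "j < n" for i j
    using T(1) that arg_cong[OF T(2), of "\<lambda>X. X $$ (i, j)"] by simp
  have "(\<Sum>i<n. (cmat T * cmat T) $$ (i, i)) = (\<Sum>i<n. \<Sum>j<n. complex_of_real ((T $$ (i, j))\<^sup>2))"
    using T(1) by (intro sum.cong)
      (auto simp: scalar_prod_def atLeast0LessThan Tsym power2_eq_square intro!: sum.cong)
  also have "\<dots> = complex_of_real (\<Sum>i<n. \<Sum>j<n. (T $$ (i, j))\<^sup>2)" by simp
  finally have "complex_of_real (\<Sum>i<n. \<Sum>j<n. (T $$ (i, j))\<^sup>2) = 0"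
    unfolding 0 by (rule sym)
  hence "(\<Sum>i<n. \<Sum>j<n. (T $$ (i, j))\<^sup>2) = 0" by (rule of_real_eq_0_iff[THEN iffD1])
  hence "\<forall>i<n. \<forall>j<n. T $$ (i, j) = 0"
    by (simp add: sum_nonneg_eq_0_iff sum_nonneg)
  hence "T = 0\<^sub>m n n" using T(1) by (intro eq_matI) auto
  with T(3) show False ..
qed

text \<open>A complex eigenvector is split as \<open>x\<close> plus \<i> times \<open>y\<close>.
  Symmetry equates \<open>y \<bullet> (T *\<^sub>v x)\<close> with
  \<open>(T *\<^sub>v y) \<bullet> x\<close>, and the difference of the two is
  \<open>Im \<mu>\<close> times the sum of the squared norms up to sign. So the eigenvalue is real,
  and whichever part is nonzero is a real eigenvector.\<close>

lemma symmetric_unit_eigenvector: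
  fixes T :: "real mat"
  assumes T: "T \<in> carrier_mat n n" "T\<^sup>T = T" "T \<noteq> 0\<^sub>m n n"
  shows "\<exists>w \<mu>. w \<in> carrier_vec n \<and> w \<bullet> w = 1 \<and> T *\<^sub>v w = \<mu> \<cdot>\<^sub>v w \<and> \<mu> \<noteq> (0 :: real)"
proof -
  obtain \<mu> v where v: "v \<in> carrier_vec n" "v \<noteq> 0\<^sub>v n" "cmat T *\<^sub>v v = \<mu> \<cdot>\<^sub>v v" and \<mu>: "\<mu> \<noteq> 0"
    using symmetric_nonzero_eigenvalue[OF T] T(1) by (auto simp: eigenvalue_def eigenvector_def)
  define x where "x = map_vec Re v"
  define y where "y = map_vec Im v"
  have xy: "x \<in> carrier_vec n" "y \<in> carrier_vec n" using v by (auto simp: x_def y_def)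
  have comp: "(cmat T *\<^sub>v v) $ i = \<mu> * v $ i" if "i < n" for i
    using v(1) that by (simp add: v(3) del: index_mult_mat_vec)
  have Tx: "T *\<^sub>v x = Re \<mu> \<cdot>\<^sub>v x - Im \<mu> \<cdot>\<^sub>v y"
  proof (rule eq_vecI)
    fix i assume "i < dim_vec (Re \<mu> \<cdot>\<^sub>v x - Im \<mu> \<cdot>\<^sub>v y)"
    hence i: "i < n" using xy by simp
    have "(T *\<^sub>v x) $ i = Re ((cmat T *\<^sub>v v) $ i)"
      using i T(1) v(1) by (simp add: scalar_prod_def x_def)
    thus "(T *\<^sub>v x) $ i = (Re \<mu> \<cdot>\<^sub>v x - Im \<mu> \<cdot>\<^sub>v y) $ i"
      unfolding comp[OF i] using i v(1) by (simp add: x_def y_def)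
  qed (use T xy in auto)
  have Ty: "T *\<^sub>v y = Re \<mu> \<cdot>\<^sub>v y + Im \<mu> \<cdot>\<^sub>v x"
  proof (rule eq_vecI)
    fix i assume "i < dim_vec (Re \<mu> \<cdot>\<^sub>v y + Im \<mu> \<cdot>\<^sub>v x)"
    hence i: "i < n" using xy by simp
    have "(T *\<^sub>v y) $ i = Im ((cmat T *\<^sub>v v) $ i)"
      using i T(1) v(1) by (simp add: scalar_prod_def y_def)
    thus "(T *\<^sub>v y) $ i = (Re \<mu> \<cdot>\<^sub>v y + Im \<mu> \<cdot>\<^sub>v x) $ i"
      unfolding comp[OF i] using i v(1) by (simp add: x_def y_def)
  qed (use T xy in auto)
  have nz: "x \<noteq> 0\<^sub>v n \<or> y \<noteq> 0\<^sub>v n"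
  proof (rule ccontr)
    assume "\<not> ?thesis"
    hence "x $ i = 0" "y $ i = 0" if "i < n" for i using that by auto
    hence "Re (v $ i) = 0" "Im (v $ i) = 0" if "i < n" for i using that v(1) by (auto simp: x_def y_def)
    hence "v = 0\<^sub>v n" using v(1) by (intro eq_vecI) (auto simp: complex_eq_iff)
    with v(2) show False ..
  qed
  have pos: "0 < u \<bullet> u" if u: "u \<in> carrier_vec n" "u \<noteq> 0\<^sub>v n" for u :: "real vec"
  proof -
    have "0 \<le> u \<bullet> u" using norm2_power2[of u] by (metis zero_le_power2)
    moreover have "u = 0\<^sub>v n" if "u \<bullet> u = 0"
    proof (rule eq_vecI)
      fix i assume "i < dim_vec (0\<^sub>v n :: real vec)"
      moreover have "\<forall>i<n. u $ i = 0"
        using that u(1) by (simp add: scalar_prod_def sum_nonneg_eq_0_iff)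
      ultimately show "u $ i = 0\<^sub>v n $ i" by simp
    qed (use u in auto)
    ultimately show ?thesis using u(2) by force
  qed
  have "y \<bullet> (T *\<^sub>v x) = (T *\<^sub>v y) \<bullet> x"
    using transpose_vec_mult_scalar[OF T(1) xy(1,2)] T(2) by simp
  hence "Im \<mu> * (x \<bullet> x + y \<bullet> y) = 0"
    unfolding Tx Ty using xy comm_scalar_prod[OF xy]
    by (simp add: scalar_prod_minus_distrib[of _ n] add_scalar_prod_distrib[of _ n] algebra_simps)
  moreover have "x \<bullet> x + y \<bullet> y > 0"
    using nz pos xy by (metis add_nonneg_pos add_pos_nonneg norm2_power2 zero_le_power2)
  ultimately have Im: "Im \<mu> = 0" by simp
  hence Re: "Re \<mu> \<noteq> 0" using \<mu> by (auto simp: complex_eq_iff)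
  have "\<exists>u. u \<in> carrier_vec n \<and> u \<noteq> 0\<^sub>v n \<and> T *\<^sub>v u = Re \<mu> \<cdot>\<^sub>v u"
  proof -
    have "0 \<cdot>\<^sub>v x = 0\<^sub>v n" "0 \<cdot>\<^sub>v y = 0\<^sub>v n" using xy by (auto intro!: eq_vecI)
    hence "T *\<^sub>v x = Re \<mu> \<cdot>\<^sub>v x" "T *\<^sub>v y = Re \<mu> \<cdot>\<^sub>v y"
      using Tx Ty xy Im by auto
    thus ?thesis using nz xy by blast
  qed
  then obtain u where u: "u \<in> carrier_vec n" "u \<noteq> 0\<^sub>v n" "T *\<^sub>v u = Re \<mu> \<cdot>\<^sub>v u" by auto
  define w where "w = (1 / norm2 u) \<cdot>\<^sub>v u"
  have "norm2 u > 0" using pos[OF u(1,2)] by (simp add: norm2_def)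
  hence "w \<bullet> w = 1" using u(1) norm2_power2[of u]
    by (auto simp: w_def power2_eq_square field_simps)
  moreover have "T *\<^sub>v w = Re \<mu> \<cdot>\<^sub>v w"
    using T(1) u by (simp add: w_def mult_mat_vec[of _ n n] smult_smult_assoc mult.commute)
  ultimately show ?thesis using u(1) Re by (intro exI[of _ w] exI[of _ "Re \<mu>"]) (auto simp: w_def)
qed

lemma minus_mat_eq_0_imp_eq:
  fixes A B :: "'a :: ab_group_add mat"
  assumes "A \<in> carrier_mat m n" "B \<in> carrier_mat m n" "A - B = 0\<^sub>m m n"
  shows "A = B"
proof (rule eq_matI)
  fix i j assume "i < dim_row B" "j < dim_col B"
  hence ij: "i < m" "j < n" using assms by auto
  have "A $$ (i, j) - B $$ (i, j) = (A - B) $$ (i, j)" using assms(1,2) ij by simp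
  thus "A $$ (i, j) = B $$ (i, j)" unfolding assms(3) using ij by simp
qed (use assms in auto)

text \<open>Negated keys turn the increasing order of \<open>sort_key\<close> into the nonincreasing
  one required of singular values.\<close>

lemma sorting_permutation:
  fixes l :: "nat \<Rightarrow> real"
  shows "\<exists>\<pi>. inj_on \<pi> {..<j} \<and> (\<forall>i<j. \<pi> i < j) \<and> (\<forall>i i'. i \<le> i' \<and> i' < j \<longrightarrow> l (\<pi> i') \<le> l (\<pi> i))"
proof -
  define xs where "xs = sort_key (\<lambda>i. - l i) [0..<j]"
  have "length xs = j" "distinct xs" "set xs = {0..<j}" "sorted (map (\<lambda>i. - l i) xs)"
    by (simp_all add: xs_def)
  hence "inj_on ((!) xs) {..<j}" "\<And>i. i < j \<Longrightarrow> xs ! i < j"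
    "\<And>i i'. i \<le> i' \<Longrightarrow> i' < j \<Longrightarrow> - l (xs ! i) \<le> - l (xs ! i')"
    using inj_on_nth[of xs "{..<j}"] nth_mem[of _ xs] sorted_nth_mono[of "map (\<lambda>i. - l i) xs"]
    by (auto simp del: nth_mem)
  thus ?thesis by (intro exI[of _ "(!) xs"]) auto
qed

text \<open>A maximal orthonormal system of eigenvectors for nonzero eigenvalues: what remains of \<open>M\<close>
  after deflation is symmetric without a nonzero eigenvalue, hence zero.\<close>

lemma symmetric_spectral_decomposition:
  fixes M :: "real mat"
  assumes M: "M \<in> carrier_mat n n" "M\<^sup>T = M"
  shows "\<exists>r W l. W \<in> carrier_mat n r \<and> W\<^sup>T * W = 1\<^sub>m r \<and> (\<forall>i<r. l i \<noteq> 0) \<and>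
    (\<forall>i i'. i \<le> i' \<and> i' < r \<longrightarrow> l i' \<le> l i) \<and> M * W = W * mat_diag r l \<and> M = W * mat_diag r l * W\<^sup>T"
proof -
  \<comment> \<open>An orthonormal system of \<open>r\<close> eigenvectors with nonzero eigenvalues,
    given by functions so that it can be permuted and extended by function update. Orthonormality
    caps \<open>r\<close> at \<open>n\<close>, which makes a maximal one available.\<close>
  define es where "es = (\<lambda>(r :: nat) v l. (\<forall>i<r. v i \<in> carrier_vec n \<and> l i \<noteq> (0 :: real) \<and> M *\<^sub>v v i = l i \<cdot>\<^sub>v v i) \<and>
      (\<forall>i<r. \<forall>i'<r. v i \<bullet> v i' = (if i = i' then 1 else 0)))"
  define mt where "mt = (\<lambda>r (v :: nat \<Rightarrow> real vec). mat n r (\<lambda>(a, i). v i $ a))"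
  have mt: "mt r v \<in> carrier_mat n r" for r v by (simp add: mt_def)
  have col: "col (mt r v) i = v i" if "es r v l" "i < r" for r v l i
    using that by (auto simp: es_def mt_def intro!: eq_vecI)
  have orth: "(mt r v)\<^sup>T * mt r v = 1\<^sub>m r" if "es r v l" for r v l
  proof (rule eq_matI)
    fix i i' assume "i < dim_row (1\<^sub>m r :: real mat)" "i' < dim_col (1\<^sub>m r :: real mat)"
    thus "((mt r v)\<^sup>T * mt r v) $$ (i, i') = 1\<^sub>m r $$ (i, i')"
      using that mt[of r v] by (simp add: col[OF that]) (simp add: es_def)
  qed (use mt[of r v] in auto)
  have eig: "M * mt r v = mt r v * mat_diag r l" if "es r v l" for r v l
  proof (rule eq_matI)
    fix a i assume "a < dim_row (mt r v * mat_diag r l)" "i < dim_col (mt r v * mat_diag r l)"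
    hence ai: "a < n" "i < r" using mt[of r v] by (auto simp: mat_diag_def)
    hence "(M * mt r v) $$ (a, i) = (M *\<^sub>v v i) $ a"
      using M mt[of r v] by (simp add: col[OF that])
    also have "M *\<^sub>v v i = l i \<cdot>\<^sub>v v i" using that ai by (simp add: es_def)
    also have "(l i \<cdot>\<^sub>v v i) $ a = v i $ a * l i"
      by (subst index_smult_vec) (use that ai in \<open>auto simp: es_def\<close>)
    also have "\<dots> = (mt r v * mat_diag r l) $$ (a, i)"
      using ai by (simp add: mat_diag_mult_right[OF mt]) (simp add: mt_def)
    finally show "(M * mt r v) $$ (a, i) = (mt r v * mat_diag r l) $$ (a, i)" .
  qed (use M mt[of r v] in \<open>auto simp: mat_diag_def\<close>)
  define Ex where "Ex = (\<lambda>r. \<exists>v l. es r v l)"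
  have "Ex 0" by (auto simp: Ex_def es_def)
  moreover have "\<forall>r. Ex r \<longrightarrow> r \<le> n"
    using orthonormal_columns_le[OF mt orth] by (auto simp: Ex_def)
  ultimately obtain r where r: "Ex r" "\<And>r'. Ex r' \<Longrightarrow> r' \<le> r"
    using GreatestI_nat[of Ex 0 n] Greatest_le_nat[of Ex _ n] by blast
  then obtain v0 l0 where v0: "es r v0 l0" by (auto simp: Ex_def)
  obtain \<pi> where \<pi>: "inj_on \<pi> {..<r}" "\<forall>i<r. \<pi> i < r"
      "\<forall>i i'. i \<le> i' \<and> i' < r \<longrightarrow> l0 (\<pi> i') \<le> l0 (\<pi> i)"
    using sorting_permutation[where l = l0 and j = r] by (elim exE conjE) rule
  define v where "v = v0 \<circ> \<pi>"
  define l where "l = l0 \<circ> \<pi>"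
  have v: "es r v l"
    unfolding es_def
  proof (intro conjI allI impI)
    fix i assume "i < r"
    hence "\<pi> i < r" using \<pi>(2) by blast
    thus "v i \<in> carrier_vec n" "l i \<noteq> 0" "M *\<^sub>v v i = l i \<cdot>\<^sub>v v i"
      using v0 by (simp_all add: es_def v_def l_def)
    fix i' assume "i' < r"
    hence "\<pi> i' < r" "\<pi> i = \<pi> i' \<longleftrightarrow> i = i'"
      using \<pi>(1,2) \<open>i < r\<close> by (auto dest: inj_onD)
    thus "v i \<bullet> v i' = (if i = i' then 1 else 0)"
      using v0 \<open>\<pi> i < r\<close> by (simp add: es_def v_def)
  qed
  define W where "W = mt r v"
  define D where "D = mat_diag r l"
  have W: "W \<in> carrier_mat n r" and WW: "W\<^sup>T * W = 1\<^sub>m r" and MW: "M * W = W * D"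
    using mt orth[OF v] eig[OF v] by (simp_all add: W_def D_def)
  have D: "D \<in> carrier_mat r r" and DT: "D\<^sup>T = D"
    by (auto simp: D_def mat_diag_def intro!: eq_matI)
  define T where "T = M - W * D * W\<^sup>T"
  have C: "W * D \<in> carrier_mat n r" "W * D * W\<^sup>T \<in> carrier_mat n n" "T \<in> carrier_mat n n"
    using W D M by (auto simp: T_def)
  have "(W * D * W\<^sup>T)\<^sup>T = W * (W * D)\<^sup>T"
    using transpose_mult[OF C(1), of "W\<^sup>T" n] W by simp
  also have "(W * D)\<^sup>T = D * W\<^sup>T"
    using transpose_mult[OF W D] by (simp only: DT)
  also have "W * (D * W\<^sup>T) = W * D * W\<^sup>T"
    using assoc_mult_mat[OF W D, of "W\<^sup>T" n] W by simp
  finally have "T\<^sup>T = T"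
    unfolding T_def by (subst transpose_minus[OF M(1) C(2)]) (simp only: M(2))
  have "T = 0\<^sub>m n n"
  proof (rule ccontr)
    assume "T \<noteq> 0\<^sub>m n n"
    then obtain w \<mu> where w: "w \<in> carrier_vec n" "w \<bullet> w = 1" "T *\<^sub>v w = \<mu> \<cdot>\<^sub>v w" "\<mu> \<noteq> 0"
      using symmetric_unit_eigenvector[OF C(3) \<open>T\<^sup>T = T\<close>] by auto
    have "T * W = M * W - W * D * W\<^sup>T * W"
      unfolding T_def using M C W by (intro minus_mult_distrib_mat) auto
    also have "W * D * W\<^sup>T * W = W * D"
      using assoc_mult_mat[OF C(1), of "W\<^sup>T" n W r] W WW right_mult_one_mat[OF C(1)] by simp
    also have "M * W - W * D = 0\<^sub>m n r" unfolding MW using C(1) by (intro eq_matI) auto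
    finally have TW: "T * W = 0\<^sub>m n r" .
    \<comment> \<open>Since \<open>T\<close> is symmetric and annihilates the columns of
      \<open>W\<close>, an eigenvector of \<open>T\<close> with nonzero eigenvalue is orthogonal to
      them. On it \<open>T\<close> and \<open>M\<close> agree, so it extends the system, against
      maximality.\<close>
    have "\<mu> \<cdot>\<^sub>v (W\<^sup>T *\<^sub>v w) = W\<^sup>T *\<^sub>v (T *\<^sub>v w)"
      unfolding w(3) using W w(1) by (simp add: mult_mat_vec[of _ r n])
    also have "\<dots> = (T * W)\<^sup>T *\<^sub>v w"
      using W C w(1) by (simp add: transpose_mult[of T n n W r] \<open>T\<^sup>T = T\<close>)
    also have "\<dots> = 0\<^sub>v r" unfolding TW using w(1) by (intro eq_vecI) auto
    finally have "\<mu> \<cdot>\<^sub>v (W\<^sup>T *\<^sub>v w) = 0\<^sub>v r" .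
    have Ww: "W\<^sup>T *\<^sub>v w = 0\<^sub>v r"
    proof (rule eq_vecI)
      fix i assume "i < dim_vec (0\<^sub>v r :: real vec)"
      hence i: "i < r" by simp
      have "(\<mu> \<cdot>\<^sub>v (W\<^sup>T *\<^sub>v w)) $ i = 0"
        using i by (simp add: \<open>\<mu> \<cdot>\<^sub>v (W\<^sup>T *\<^sub>v w) = 0\<^sub>v r\<close>)
      thus "(W\<^sup>T *\<^sub>v w) $ i = 0\<^sub>v r $ i" using i W w(4) by simp
    qed (use W in simp)
    have vw: "v i \<bullet> w = 0" if "i < r" for i
      using arg_cong[OF Ww, of "\<lambda>u. u $ i"] that W col[OF v, of i] by (simp add: W_def)
    have "M *\<^sub>v w = T *\<^sub>v w + W * D * W\<^sup>T *\<^sub>v w"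
    proof -
      have "M = T + W * D * W\<^sup>T" unfolding T_def by (rule eq_matI) (use M(1) C(2) W in simp_all)
      thus ?thesis using C w(1) add_mult_distrib_mat_vec[of T n n "W * D * W\<^sup>T" w] by simp
    qed
    also have "W * D * W\<^sup>T *\<^sub>v w = 0\<^sub>v n"
    proof -
      have "W * D * W\<^sup>T *\<^sub>v w = W * D *\<^sub>v 0\<^sub>v r"
        using assoc_mult_mat_vec[OF C(1), of "W\<^sup>T" n w] W w(1) Ww by simp
      also have "\<dots> = 0\<^sub>v n" using C(1) by (intro eq_vecI) (auto simp: scalar_prod_def)
      finally show ?thesis .
    qed
    finally have Mw: "M *\<^sub>v w = \<mu> \<cdot>\<^sub>v w"
      unfolding w(3) by (subst (asm) right_zero_vec) (use w(1) in auto)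
    have wv: "w \<bullet> v i = 0" if "i < r" for i
      using vw[OF that] comm_scalar_prod[of w n "v i"] w(1) v that by (simp add: es_def)
    have "es (Suc r) (v(r := w)) (l(r := \<mu>))"
      using v w Mw vw wv by (auto simp: es_def less_Suc_eq)
    with r(2)[of "Suc r"] show False by (auto simp: Ex_def)
  qed
  hence "M = W * D * W\<^sup>T"
    unfolding T_def by (rule minus_mat_eq_0_imp_eq[OF M(1) C(2)])
  moreover have "\<forall>i<r. l i \<noteq> 0" using v by (simp add: es_def)
  moreover have "\<forall>i i'. i \<le> i' \<and> i' < r \<longrightarrow> l i' \<le> l i" using \<pi>(3) by (simp add: l_def)
  ultimately show ?thesis using W WW MW unfolding D_def by blast
qed

section \<open>From the spectral decomposition to the singular value decomposition\<close>

lemma transpose_mult_self_eq_0: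
  fixes Z :: "real mat"
  assumes Z: "Z \<in> carrier_mat m n" "Z\<^sup>T * Z = 0\<^sub>m n n"
  shows "Z = 0\<^sub>m m n"
proof (rule eq_matI)
  fix a j assume "a < dim_row (0\<^sub>m m n :: real mat)" "j < dim_col (0\<^sub>m m n :: real mat)"
  hence aj: "a < m" "j < n" by auto
  have "(\<Sum>a<m. (Z $$ (a, j))\<^sup>2) = (Z\<^sup>T * Z) $$ (j, j)"
    using Z(1) aj by (simp add: scalar_prod_def power2_eq_square atLeast0LessThan)
  hence "(\<Sum>a<m. (Z $$ (a, j))\<^sup>2) = 0" using Z(2) aj by simp
  thus "Z $$ (a, j) = 0\<^sub>m m n $$ (a, j)" using aj by (simp add: sum_nonneg_eq_0_iff)
qed (use Z in auto)

text \<open>The columns of \<open>W\<close> diagonalize \<open>A\<^sup>T * A\<close>; its nonzero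
  eigenvalues are squared column norms of \<open>A * W\<close>, hence positive. Their roots are the
  singular values, and dividing the columns of \<open>A * W\<close> by them gives
  \<open>U\<close>.\<close>

lemma compact_svd_exists: "\<exists>r U s V. is_compact_svd A r U s V"
proof -
  define m n where "m = dim_row A" and "n = dim_col A"
  have A: "A \<in> carrier_mat m n" by (simp add: m_def n_def)
  define M where "M = A\<^sup>T * A"
  have M: "M \<in> carrier_mat n n" "M\<^sup>T = M"
    using A by (auto simp: M_def transpose_mult[of "A\<^sup>T" n m A n])
  obtain r W l where W: "W \<in> carrier_mat n r" "W\<^sup>T * W = 1\<^sub>m r" and l: "\<forall>i<r. l i \<noteq> 0"
      "\<forall>i i'. i \<le> i' \<and> i' < r \<longrightarrow> l i' \<le> l i" and
      MW: "M * W = W * mat_diag r l" "M = W * mat_diag r l * W\<^sup>T"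
    using symmetric_spectral_decomposition[OF M] by blast
  define X where "X = A * W"
  have X: "X \<in> carrier_mat m r" using A W by (simp add: X_def)
  have "X\<^sup>T * X = W\<^sup>T * A\<^sup>T * (A * W)"
    using A W by (simp add: X_def transpose_mult[of A m n W r])
  also have "\<dots> = W\<^sup>T * (M * W)"
    using A W(1) by (simp add: M_def assoc_mult_mat[of "W\<^sup>T" r n "A\<^sup>T" m _ r] assoc_mult_mat[of "A\<^sup>T" n m A n W r])
  also have "\<dots> = W\<^sup>T * W * mat_diag r l"
    unfolding MW(1) using W(1) by (simp add: assoc_mult_mat[of "W\<^sup>T" r n W r _ r])
  finally have XX: "X\<^sup>T * X = mat_diag r l"
    unfolding W(2) using left_mult_one_mat[OF mat_diag_dim] by simp
  have l0: "0 < l i" if i: "i < r" for i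
  proof -
    have "l i = (X\<^sup>T * X) $$ (i, i)" unfolding XX using i by (simp add: mat_diag_def)
    also have "\<dots> = (\<Sum>a<m. (X $$ (a, i))\<^sup>2)"
      using X i by (simp add: scalar_prod_def power2_eq_square atLeast0LessThan)
    finally have "0 \<le> l i" by (simp add: sum_nonneg)
    with l(1) i show ?thesis by force
  qed
  define s where "s i = sqrt (l i)" for i
  define S' where "S' = mat_diag r (\<lambda>i. 1 / s i)"
  have S': "S' \<in> carrier_mat r r" "S'\<^sup>T = S'"
    by (auto simp: S'_def mat_diag_def intro!: eq_matI)
  have diag_1: "mat_diag r h = 1\<^sub>m r" if "\<And>i. i < r \<Longrightarrow> h i = 1" for h :: "nat \<Rightarrow> real"
    using that by (intro eq_matI) (auto simp: mat_diag_def)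
  define U where "U = X * S'"
  have U: "U \<in> carrier_mat m r" using X S' by (simp add: U_def)
  have "U\<^sup>T * U = S' * X\<^sup>T * (X * S')"
    using X S' by (simp add: U_def transpose_mult[of X m r S' r])
  also have "\<dots> = S' * (X\<^sup>T * X) * S'"
    using X S'(1) by (simp add: assoc_mult_mat[of S' r r "X\<^sup>T" m _ r] assoc_mult_mat[of "X\<^sup>T" r m X r S' r]
        assoc_mult_mat[of S' r r _ r _ r])
  also have "\<dots> = 1\<^sub>m r"
    unfolding XX S'_def mat_diag_diag using l0 by (intro diag_1) (force simp: s_def)
  finally have UU: "U\<^sup>T * U = 1\<^sub>m r" .
  have "S' * mat_diag r s = 1\<^sub>m r"
    unfolding S'_def mat_diag_diag using l0 by (intro diag_1) (force simp: s_def)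
  hence US: "U * mat_diag r s = X"
    using X S' by (simp add: U_def assoc_mult_mat[of X m r S' r _ r])
  \<comment> \<open>The projector onto the complement of the columns of \<open>W\<close>. As
    \<open>M * E\<close> vanishes, so does \<open>(A * E)\<^sup>T * (A * E)\<close>, thus
    \<open>A * E\<close> itself: \<open>A\<close> is determined by its action on
    \<open>W\<close>.\<close>
  define E where "E = 1\<^sub>m n - W * W\<^sup>T"
  have WW: "W * W\<^sup>T \<in> carrier_mat n n" using W by simp
  hence E: "E \<in> carrier_mat n n" unfolding E_def by (rule minus_carrier_mat)
  have "M * E = M * 1\<^sub>m n - M * (W * W\<^sup>T)"
    unfolding E_def using M(1) WW by (intro mult_minus_distrib_mat) auto
  also have "M * (W * W\<^sup>T) = M"
    using assoc_mult_mat[of M n n W r "W\<^sup>T" n] M(1) W(1) by (simp only: MW(1) MW(2)[symmetric]) simp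
  finally have ME: "M * E = 0\<^sub>m n n" using M(1) by simp
  define Z where "Z = A * E"
  have Z: "Z \<in> carrier_mat m n" using A E by (simp add: Z_def)
  have "Z\<^sup>T * Z = E\<^sup>T * A\<^sup>T * (A * E)"
    using A E by (simp add: Z_def transpose_mult[of A m n E n])
  also have "\<dots> = E\<^sup>T * (M * E)"
    using A E by (simp add: M_def assoc_mult_mat[of "E\<^sup>T" n n "A\<^sup>T" m _ n] assoc_mult_mat[of "A\<^sup>T" n m A n E n])
  also have "\<dots> = 0\<^sub>m n n" unfolding ME using E by (intro right_mult_zero_mat) simp
  finally have "Z = 0\<^sub>m m n" by (rule transpose_mult_self_eq_0[OF Z])
  moreover have "Z = A - X * W\<^sup>T"
    unfolding Z_def E_def X_def using A W(1) WW
    by (simp add: mult_minus_distrib_mat[of A m n "1\<^sub>m n" n "W * W\<^sup>T"] assoc_mult_mat[of A m n W r "W\<^sup>T" n])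
  ultimately have eq: "A - X * W\<^sup>T = 0\<^sub>m m n" by simp
  have XW: "X * W\<^sup>T \<in> carrier_mat m n" using X W by simp
  have AX: "A = X * W\<^sup>T"
    by (rule minus_mat_eq_0_imp_eq[OF A XW eq])
  have "\<forall>i<r. 0 < s i" "\<forall>i j. i \<le> j \<and> j < r \<longrightarrow> s j \<le> s i"
    using l0 l(2) by (auto simp: s_def)
  hence "is_compact_svd A r U s W"
    unfolding is_compact_svd_def US using U UU W AX m_def n_def by blast
  thus ?thesis by blast
qed

lemma is_compact_svd_compact_svd:
  assumes "compact_svd A = (r, U, s, V)"
  shows "is_compact_svd A r U s V"
proof -
  have "case compact_svd A of (r, U, s, V) \<Rightarrow> is_compact_svd A r U s V"
    unfolding compact_svd_def by (rule someI_ex) (use compact_svd_exists[of A] in auto)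
  thus ?thesis using assms by simp
qed

section \<open>Exactness of the rational Krylov approximation\<close>

lemma module_module_vec: "Module.module class_ring (module_vec TYPE(complex) n)"
  using vec_vs by (rule vectorspace.axioms(1))

text \<open>The vectors on which two matrices agree form a submodule, so agreement on generators
  passes to the span without explicit linear combinations. Taking \<open>X\<close> equal to
  \<open>Y\<close> yields the bare membership in \<open>carrier_vec\<close>.\<close>

lemma vspan_equalizer:
  assumes S: "S \<subseteq> carrier_vec n" and X: "X \<in> carrier_mat m n" and Y: "Y \<in> carrier_mat m n"
    and eq: "\<And>w. w \<in> S \<Longrightarrow> X *\<^sub>v w = Y *\<^sub>v w" and x: "x \<in> vspan n S"
  shows "x \<in> carrier_vec n" "X *\<^sub>v x = Y *\<^sub>v x"
proof -
  define E where "E = {w \<in> carrier_vec n. X *\<^sub>v w = Y *\<^sub>v w}"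
  have add: "v + w \<in> E" if "v \<in> E" "w \<in> E" for v w
    using that X Y by (simp add: E_def mult_add_distrib_mat_vec[of _ m n])
  have zero: "0\<^sub>v n \<in> E" using X Y by (auto simp: E_def intro!: eq_vecI)
  have smult: "c \<cdot>\<^sub>v v \<in> E" if "v \<in> E" for c v
    using that X Y by (simp add: E_def mult_mat_vec[of _ m n])
  have "submodule class_ring E (module_vec TYPE(complex) n)"
    by (intro submodule.intro module_module_vec)
      (auto simp: module_vec_simps add zero smult, simp add: E_def)
  moreover have "S \<subseteq> E" using S eq by (auto simp: E_def)
  ultimately have "vspan n S \<subseteq> E"
    unfolding vspan_def by (intro LinearCombinations.module.span_is_subset[OF module_module_vec])
  thus "x \<in> carrier_vec n" "X *\<^sub>v x = Y *\<^sub>v x" using x by (auto simp: E_def)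
qed

lemma vspan_superset: "S \<subseteq> carrier_vec n \<Longrightarrow> x \<in> S \<Longrightarrow> x \<in> vspan n S"
  using LinearCombinations.module.in_own_span[OF module_module_vec, of S n]
  by (auto simp: vspan_def module_vec_simps)

text \<open>\<open>C * C\<^sup>T\<close> fixes the columns of \<open>C\<close>, hence their complex
  span. The plain transpose serves as the adjoint because the entries are real.\<close>

lemma real_onb_projection:
  assumes "real_onb n k Q S" "x \<in> S"
  shows "x \<in> carrier_vec n" "cmat Q *\<^sub>v ((cmat Q)\<^sup>T *\<^sub>v x) = x"
proof -
  define C where "C = cmat Q"
  have C: "C \<in> carrier_mat n k" and S: "vspan n (set (cols C)) = S"
    using assms(1) by (auto simp: real_onb_def C_def)
  have "Q\<^sup>T * Q = 1\<^sub>m k" "Q \<in> carrier_mat n k" using assms(1) by (auto simp: real_onb_def)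
  moreover from this have "C\<^sup>T * C = cmat (Q\<^sup>T * Q)"
    unfolding C_def map_mat_transpose by (intro of_real_hom.mat_hom_mult[symmetric]) auto
  ultimately have CC: "C\<^sup>T * C = 1\<^sub>m k" by (simp add: of_real_hom.mat_hom_one)
  have "C * C\<^sup>T * C = C"
    using assoc_mult_mat[of C n k "C\<^sup>T" n C k] C CC by simp
  moreover have "(C * C\<^sup>T *\<^sub>v col C j) = col (C * C\<^sup>T * C) j" if "j < k" for j
    using C that by (intro col_mult2[symmetric, of _ n n _ k]) auto
  ultimately have eqv: "C * C\<^sup>T *\<^sub>v w = 1\<^sub>m n *\<^sub>v w" if "w \<in> set (cols C)" for w
    using C that cols_dim[of C] by (auto simp: cols_def)
  have "set (cols C) \<subseteq> carrier_vec n" "C * C\<^sup>T \<in> carrier_mat n n" "x \<in> vspan n (set (cols C))"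
    using cols_dim[of C] C S assms(2) by auto
  from vspan_equalizer[OF this(1,2) one_carrier_mat eqv this(3)] have "x \<in> carrier_vec n" "C * C\<^sup>T *\<^sub>v x = x" by auto
  thus "x \<in> carrier_vec n" "cmat Q *\<^sub>v ((cmat Q)\<^sup>T *\<^sub>v x) = x"
    using C by (auto simp: C_def[symmetric])
qed

text \<open>A rational Krylov space is the polynomial Krylov space of the vector \<open>G *\<^sub>v c\<close>.\<close>

lemma rat_krylov_contains:
  assumes M: "M \<in> carrier_mat n n" and c: "c \<in> carrier_vec n"
    and onb: "real_onb n k Q (rat_krylov q k M c)"
    and G: "G = the (mat_inverse (poly_mat q M))" "G \<in> carrier_mat n n"
      "poly_mat q M * G = 1\<^sub>m n" "G * poly_mat q M = 1\<^sub>m n"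
    and g: "degree g < k"
  shows "cmat Q *\<^sub>v ((cmat Q)\<^sup>T *\<^sub>v (poly_mat g M *\<^sub>v (G *\<^sub>v c))) = poly_mat g M *\<^sub>v (G *\<^sub>v c)"
proof -
  have Q: "cmat Q \<in> carrier_mat n k" using onb by (simp add: real_onb_def)
  define v where "v = G *\<^sub>v c"
  have v: "v \<in> carrier_vec n" using G c by (simp add: v_def)
  have qM: "poly_mat q M \<in> carrier_mat n n" using M by simp
  \<comment> \<open>Insert \<open>q(M) * G = 1\<close> and move \<open>M\<close> past
    \<open>q(M)\<close>: what commutes with \<open>q(M)\<close> commutes with its inverse.\<close>
  have "G * M = G * M * (poly_mat q M * G)"
    using right_mult_one_mat[OF mult_carrier_mat[OF G(2) M]] by (simp add: G(3))
  also have "\<dots> = G * (M * poly_mat q M) * G"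
    using assoc_mult_mat[OF mult_carrier_mat[OF G(2) M] qM G(2)] assoc_mult_mat[OF G(2) M qM] by simp
  also have "\<dots> = G * poly_mat q M * (M * G)"
    unfolding poly_mat_commute[OF M]
    using assoc_mult_mat[OF G(2) qM M] assoc_mult_mat[OF mult_carrier_mat[OF G(2) qM] M G(2)] by simp
  also have "\<dots> = M * G"
    using left_mult_one_mat[OF mult_carrier_mat[OF M G(2)]] by (simp add: G(4))
  finally have GM: "G * M = M * G" .
  have base: "cmat Q *\<^sub>v ((cmat Q)\<^sup>T *\<^sub>v (poly_mat (monom a i) M *\<^sub>v v)) = poly_mat (monom a i) M *\<^sub>v v"
    if i: "i < k" for a i
  proof -
    have "poly_mat (monom 1 i) M *\<^sub>v v = G *\<^sub>v (poly_mat (monom 1 i) M *\<^sub>v c)"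
      using poly_mat_intertwine[OF G(2) M M GM, of "monom 1 i"]
        assoc_mult_mat_vec[OF G(2) poly_mat_carrier[OF M, of "monom 1 i"] c]
        assoc_mult_mat_vec[OF poly_mat_carrier[OF M, of "monom 1 i"] G(2) c]
      by (simp add: v_def)
    also have "poly_mat (monom 1 i) M *\<^sub>v c = (M ^\<^sub>m i) *\<^sub>v c"
      by (simp add: poly_mat_monom_mult_vec[OF M c])
    also have "G *\<^sub>v ((M ^\<^sub>m i) *\<^sub>v c) \<in> rat_krylov q k M c"
      unfolding rat_krylov_def G(1)[symmetric] using M i mult_mat_vec_carrier[OF pow_carrier_mat[OF M] c]
      by (intro imageI vspan_superset) auto
    finally have mem: "poly_mat (monom 1 i) M *\<^sub>v v \<in> rat_krylov q k M c" .
    have "poly_mat (monom a i) M *\<^sub>v v = a \<cdot>\<^sub>v (poly_mat (monom 1 i) M *\<^sub>v v)"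
      by (simp add: poly_mat_monom_mult_vec[OF M v])
    thus ?thesis
      using real_onb_projection[OF onb mem] Q by (simp add: mult_mat_vec[of _ k n] mult_mat_vec[of _ n k])
  qed
  have add: "cmat Q *\<^sub>v ((cmat Q)\<^sup>T *\<^sub>v (poly_mat (g + h) M *\<^sub>v v)) = poly_mat (g + h) M *\<^sub>v v"
    if "cmat Q *\<^sub>v ((cmat Q)\<^sup>T *\<^sub>v (poly_mat g M *\<^sub>v v)) = poly_mat g M *\<^sub>v v"
       "cmat Q *\<^sub>v ((cmat Q)\<^sup>T *\<^sub>v (poly_mat h M *\<^sub>v v)) = poly_mat h M *\<^sub>v v" for g h
  proof -
    have C: "poly_mat g M *\<^sub>v v \<in> carrier_vec n" "poly_mat h M *\<^sub>v v \<in> carrier_vec n"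
      by (rule mult_mat_vec_carrier[OF poly_mat_carrier[OF M] v])+
    have "poly_mat (g + h) M *\<^sub>v v = poly_mat g M *\<^sub>v v + poly_mat h M *\<^sub>v v"
      unfolding poly_mat_add[OF M] by (rule add_mult_distrib_mat_vec[OF poly_mat_carrier[OF M] poly_mat_carrier[OF M] v])
    thus ?thesis
      using that C Q mult_add_distrib_mat_vec[of "(cmat Q)\<^sup>T" k n, OF _ C]
        mult_add_distrib_mat_vec[of "cmat Q" n k "(cmat Q)\<^sup>T *\<^sub>v (poly_mat g M *\<^sub>v v)"
          "(cmat Q)\<^sup>T *\<^sub>v (poly_mat h M *\<^sub>v v)"]
      by simp
  qed
  have "0 < k" using g by simp
  have sums: "cmat Q *\<^sub>v ((cmat Q)\<^sup>T *\<^sub>v (poly_mat (\<Sum>i\<in>I. monom (coeff g i) i) M *\<^sub>v v))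
      = poly_mat (\<Sum>i\<in>I. monom (coeff g i) i) M *\<^sub>v v" if "finite I" "I \<subseteq> {..<k}" for I
    using that
  proof (induction I)
    case empty
    show ?case using base[OF \<open>0 < k\<close>, of 0] by simp
  next
    case (insert i I)
    thus ?case by (simp add: add base)
  qed
  have "{..degree g} \<subseteq> {..<k}" using g by auto
  from sums[OF finite_atMost this] show ?thesis
    unfolding poly_as_sum_of_monoms v_def .
qed

text \<open>The point is that \<open>A\<close> maps the first Krylov space into the second: moving
  \<open>A\<close> to the right past the inverse of \<open>q\<close> and past powers turns functions
  of \<open>A * A\<^sup>T\<close> into the same functions of \<open>A\<^sup>T * A\<close>. On the
  second space \<open>P * P\<^sup>T\<close> is the identity.\<close>

lemma rat_krylov_image:
  fixes A :: "real mat"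
  assumes A: "A \<in> carrier_mat m n" and b: "b \<in> carrier_vec n"
    and poles: "\<And>j c. 1 \<le> j \<Longrightarrow> j \<le> k - 1 \<Longrightarrow> \<xi> j = Some c \<Longrightarrow>
        \<not> eigenvalue (cmat (A\<^sup>T * A)) c \<and> \<not> eigenvalue (cmat (A * A\<^sup>T)) c"
    and q: "q = pole_poly \<xi> k"
    and Q: "real_onb n k Q (rat_krylov q k (cmat (A\<^sup>T * A)) (cvec b))"
    and P: "real_onb m k P (rat_krylov q k (cmat (A * A\<^sup>T)) (cvec (A *\<^sub>v b)))"
  shows "P * P\<^sup>T * (A * Q) = A * Q"
proof -
  define Ac M N Pc Qc where "Ac = cmat A" and "M = cmat (A\<^sup>T * A)" and "N = cmat (A * A\<^sup>T)"
    and "Pc = cmat P" and "Qc = cmat Q"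
  have C: "Ac \<in> carrier_mat m n" "M \<in> carrier_mat n n" "N \<in> carrier_mat m m"
    "Pc \<in> carrier_mat m k" "Qc \<in> carrier_mat n k" "P \<in> carrier_mat m k" "Q \<in> carrier_mat n k"
    using A P Q by (auto simp: Ac_def M_def N_def Pc_def Qc_def real_onb_def)
  have AM: "Ac * M = N * Ac"
  proof -
    have "Ac * M = cmat (A * (A\<^sup>T * A))"
      unfolding Ac_def M_def using A by (intro of_real_hom.mat_hom_mult[symmetric]) auto
    also have "A * (A\<^sup>T * A) = A * A\<^sup>T * A"
      by (rule assoc_mult_mat[symmetric]) (use A in auto)
    also have "cmat (A * A\<^sup>T * A) = N * Ac"
      unfolding Ac_def N_def using A by (intro of_real_hom.mat_hom_mult) auto
    finally show ?thesis .
  qed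
  define G where "G = the (mat_inverse (poly_mat q M))"
  define H where "H = the (mat_inverse (poly_mat q N))"
  have G: "G \<in> carrier_mat n n" "poly_mat q M * G = 1\<^sub>m n" "G * poly_mat q M = 1\<^sub>m n"
    unfolding q using poles by (intro mat_inverse_pole_poly[OF C(2) _ G_def[unfolded q]]; auto simp: M_def)+
  have H: "H \<in> carrier_mat m m" "poly_mat q N * H = 1\<^sub>m m" "H * poly_mat q N = 1\<^sub>m m"
    unfolding q using poles by (intro mat_inverse_pole_poly[OF C(3) _ H_def[unfolded q]]; auto simp: N_def)+
  have HA: "H * Ac = Ac * G"
  proof -
    have qM: "poly_mat q M \<in> carrier_mat n n" "poly_mat q N \<in> carrier_mat m m" using C by auto
    have "H * Ac = H * (Ac * (poly_mat q M * G))" using C right_mult_one_mat[OF C(1)] by (simp add: G(2))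
    also have "Ac * (poly_mat q M * G) = poly_mat q N * Ac * G"
      using assoc_mult_mat[OF C(1) qM(1) G(1)] poly_mat_intertwine[OF C(1-3) AM, of q] by simp
    also have "\<dots> = poly_mat q N * (Ac * G)" by (rule assoc_mult_mat[OF qM(2) C(1) G(1)])
    also have "H * \<dots> = H * poly_mat q N * (Ac * G)"
      by (rule assoc_mult_mat[OF H(1) qM(2) mult_carrier_mat[OF C(1) G(1)], symmetric])
    also have "\<dots> = Ac * G"
      using left_mult_one_mat[OF mult_carrier_mat[OF C(1) G(1)]] by (simp add: H(3))
    finally show ?thesis .
  qed
  have cb: "cvec b \<in> carrier_vec n" "cvec (A *\<^sub>v b) \<in> carrier_vec m" "cvec (A *\<^sub>v b) = Ac *\<^sub>v cvec b"
    using A b by (auto simp: Ac_def of_real_hom.mult_mat_vec_hom)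
  define S where "S = (\<lambda>i. (M ^\<^sub>m i) *\<^sub>v cvec b) ` {..<k}"
  have S: "S \<subseteq> carrier_vec n"
    using mult_mat_vec_carrier[OF pow_carrier_mat[OF C(2)] cb(1)] by (auto simp: S_def)
  have AG: "Ac * G \<in> carrier_mat m n" using C G by simp
  have PAG: "Pc * Pc\<^sup>T * (Ac * G) \<in> carrier_mat m n" using C AG by simp
  \<comment> \<open>The inverse \<open>G\<close> is kept inside the matrices, so that the comparison
    takes place on the generators \<open>M ^\<^sub>m i *\<^sub>v cvec b\<close> of an honest
    span.\<close>
  have eqv: "Pc * Pc\<^sup>T * (Ac * G) *\<^sub>v w = Ac * G *\<^sub>v w" if w: "w \<in> S" for w
  proof -
    obtain i where i: "i < k" "w = (M ^\<^sub>m i) *\<^sub>v cvec b" using w by (auto simp: S_def)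
    have w': "w = poly_mat (monom 1 i) M *\<^sub>v cvec b"
      using poly_mat_monom_mult_vec[OF C(2) cb(1), of 1 i] i by simp
    have wc: "w \<in> carrier_vec n" using w S by auto
    have mM: "poly_mat (monom 1 i) M \<in> carrier_mat n n" "poly_mat (monom 1 i) N \<in> carrier_mat m m"
      using C by auto
    have "Ac * G *\<^sub>v w = H *\<^sub>v (Ac *\<^sub>v w)"
      unfolding HA[symmetric] by (rule assoc_mult_mat_vec[OF H(1) C(1) wc])
    also have "Ac *\<^sub>v w = poly_mat (monom 1 i) N *\<^sub>v (Ac *\<^sub>v cvec b)"
      unfolding w' using assoc_mult_mat_vec[OF C(1) mM(1) cb(1)] assoc_mult_mat_vec[OF mM(2) C(1) cb(1)]
        poly_mat_intertwine[OF C(1-3) AM, of "monom 1 i"] by simp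
    also have "\<dots> = (N ^\<^sub>m i) *\<^sub>v cvec (A *\<^sub>v b)"
      using poly_mat_monom_mult_vec[OF C(3) cb(2), of 1 i] by (simp add: cb(3))
    also have "H *\<^sub>v \<dots> \<in> rat_krylov q k N (cvec (A *\<^sub>v b))"
      unfolding rat_krylov_def H_def[symmetric]
      using C i mult_mat_vec_carrier[OF pow_carrier_mat[OF C(3)] cb(2)] by (intro imageI vspan_superset) auto
    finally have "Pc *\<^sub>v (Pc\<^sup>T *\<^sub>v (Ac * G *\<^sub>v w)) = Ac * G *\<^sub>v w"
      unfolding Pc_def using P[folded N_def] by (rule real_onb_projection(2)[rotated])
    thus ?thesis
      using assoc_mult_mat_vec[of "Pc * Pc\<^sup>T" m m "Ac * G" n w]
        assoc_mult_mat_vec[of Pc m k "Pc\<^sup>T" m "Ac * G *\<^sub>v w"] C AG wc by simp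
  qed
  have PPA: "Pc * Pc\<^sup>T * Ac \<in> carrier_mat m n" using C by simp
  have PP: "Pc * Pc\<^sup>T \<in> carrier_mat m m" using C by simp
  have "(Pc * Pc\<^sup>T * Ac) *\<^sub>v x = Ac *\<^sub>v x" if x: "x \<in> rat_krylov q k M (cvec b)" for x
  proof -
    obtain w where w: "w \<in> vspan n S" "x = G *\<^sub>v w"
      using x C(2) by (auto simp: rat_krylov_def S_def G_def)
    have wc: "w \<in> carrier_vec n" by (rule vspan_equalizer(1)[OF S AG AG refl w(1)])
    have "(Pc * Pc\<^sup>T * Ac) *\<^sub>v x = Pc * Pc\<^sup>T *\<^sub>v (Ac *\<^sub>v (G *\<^sub>v w))"
      unfolding w(2) using assoc_mult_mat_vec[OF PP C(1)] G(1) wc by simp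
    also have "Ac *\<^sub>v (G *\<^sub>v w) = Ac * G *\<^sub>v w"
      by (rule assoc_mult_mat_vec[OF C(1) G(1) wc, symmetric])
    also have "Pc * Pc\<^sup>T *\<^sub>v \<dots> = Pc * Pc\<^sup>T * (Ac * G) *\<^sub>v w"
      by (rule assoc_mult_mat_vec[OF PP AG wc, symmetric])
    also have "\<dots> = Ac * G *\<^sub>v w" by (rule vspan_equalizer(2)[OF S PAG AG eqv w(1)])
    also have "\<dots> = Ac *\<^sub>v x" unfolding w(2) by (rule assoc_mult_mat_vec[OF C(1) G(1) wc])
    finally show ?thesis .
  qed
  moreover have "col Qc j \<in> rat_krylov q k M (cvec b)" if "j < k" for j
  proof -
    have "col Qc j \<in> set (cols Qc)" using that C by (auto simp: cols_def)
    moreover have "set (cols Qc) \<subseteq> carrier_vec n" using cols_dim[of Qc] C by simp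
    moreover have "vspan n (set (cols Qc)) = rat_krylov q k M (cvec b)"
      using Q by (simp add: real_onb_def Qc_def M_def)
    ultimately show ?thesis using vspan_superset by blast
  qed
  ultimately have cols: "(Pc * Pc\<^sup>T * Ac) *\<^sub>v col Qc j = Ac *\<^sub>v col Qc j" if "j < k" for j
    using that by blast
  have "Pc * Pc\<^sup>T * Ac * Qc = Ac * Qc"
  proof (rule eq_matI)
    fix i j assume "i < dim_row (Ac * Qc)" "j < dim_col (Ac * Qc)"
    hence ij: "i < m" "j < k" using C by auto
    have "(Pc * Pc\<^sup>T * Ac * Qc) $$ (i, j) = ((Pc * Pc\<^sup>T * Ac) *\<^sub>v col Qc j) $ i"
      using ij C PPA by simp
    also have "\<dots> = (Ac *\<^sub>v col Qc j) $ i" by (simp only: cols[OF ij(2)])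
    also have "\<dots> = (Ac * Qc) $$ (i, j)" using ij C by simp
    finally show "(Pc * Pc\<^sup>T * Ac * Qc) $$ (i, j) = (Ac * Qc) $$ (i, j)" .
  qed (use C in auto)
  hence "Pc * Pc\<^sup>T * (Ac * Qc) = Ac * Qc"
    using assoc_mult_mat[OF PP C(1) C(5)] by simp
  moreover have "Pc * Pc\<^sup>T = cmat (P * P\<^sup>T)"
    unfolding Pc_def map_mat_transpose using C by (intro of_real_hom.mat_hom_mult[symmetric]) auto
  moreover have "Ac * Qc = cmat (A * Q)"
    unfolding Ac_def Qc_def using A C by (intro of_real_hom.mat_hom_mult[symmetric]) auto
  moreover have "cmat (P * P\<^sup>T) * cmat (A * Q) = cmat (P * P\<^sup>T * (A * Q))"
    using A C by (intro of_real_hom.mat_hom_mult[symmetric, of _ m m _ k]) auto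
  ultimately have "cmat (P * P\<^sup>T * (A * Q)) = cmat (A * Q)" by simp
  thus ?thesis by (rule of_real_hom.mat_hom_inj)
qed

text \<open>Each Horner step applies the compression of \<open>M\<close> instead of
  \<open>M\<close>, that is, it inserts the projection \<open>C * C\<^sup>T\<close>. As long as the
  degree stays below \<open>k\<close>, the vector lies in the Krylov space and the projection does
  nothing.\<close>

lemma krylov_poly_exact:
  fixes C :: "complex mat"
  assumes M: "M \<in> carrier_mat n n" and v: "v \<in> carrier_vec n" and Q: "C \<in> carrier_mat n k"
    and proj: "\<And>g. degree g < k \<Longrightarrow> C *\<^sub>v (C\<^sup>T *\<^sub>v (poly_mat g M *\<^sub>v v)) = poly_mat g M *\<^sub>v v"
    and g: "degree g < k"
  shows "C *\<^sub>v (poly_mat g (C\<^sup>T * M * C) *\<^sub>v (C\<^sup>T *\<^sub>v v)) = poly_mat g M *\<^sub>v v"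
  using g
proof (induction g)
  case 0
  have "C\<^sup>T * M * C \<in> carrier_mat k k" using Q M by simp
  moreover have "0\<^sub>m l l *\<^sub>v x = 0\<^sub>v l" if "x \<in> carrier_vec l" for l and x :: "complex vec"
    using that by (intro eq_vecI) (auto simp: scalar_prod_def)
  moreover have "C *\<^sub>v 0\<^sub>v k = 0\<^sub>v n" using Q by (intro eq_vecI) (auto simp: scalar_prod_def)
  ultimately show ?case using M v Q by (simp add: poly_mat_0[of _ k] poly_mat_0[OF M] del: assoc_mult_mat)
next
  case (pCons a g)
  define H where "H = C\<^sup>T * M * C"
  have H: "H \<in> carrier_mat k k" using Q M by (simp add: H_def)
  have Cv: "C\<^sup>T *\<^sub>v v \<in> carrier_vec k" using Q v by simp
  \<comment> \<open>Horner's rule with \<open>X\<close> as the outermost factor, so that the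
    projection acts on the vector obtained last.\<close>
  have step: "poly_mat (pCons a g) X *\<^sub>v x = a \<cdot>\<^sub>v x + X *\<^sub>v (poly_mat g X *\<^sub>v x)"
    if "X \<in> carrier_mat l l" "x \<in> carrier_vec l" for X x l
  proof -
    have pX: "poly_mat g X \<in> carrier_mat l l" using that by simp
    have "poly_mat (pCons a g) X *\<^sub>v x = (a \<cdot>\<^sub>m 1\<^sub>m l) *\<^sub>v x + (poly_mat g X * X) *\<^sub>v x"
      unfolding poly_mat_pCons[OF that(1)]
      using that mult_carrier_mat[OF pX that(1)] by (intro add_mult_distrib_mat_vec) auto
    also have "(a \<cdot>\<^sub>m 1\<^sub>m l) *\<^sub>v x = a \<cdot>\<^sub>v x"
      using that(2) smult_mat_mult_vec[of "1\<^sub>m l" l l x a] by simp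
    also have "poly_mat g X * X = X * poly_mat g X" by (rule poly_mat_commute[OF that(1), symmetric])
    also have "X * poly_mat g X *\<^sub>v x = X *\<^sub>v (poly_mat g X *\<^sub>v x)"
      by (rule assoc_mult_mat_vec[OF that(1) pX that(2)])
    finally show ?thesis .
  qed
  have "degree g < k" using pCons.prems by (auto simp: degree_pCons_eq_if split: if_splits)
  with pCons.IH have IH: "C *\<^sub>v (poly_mat g H *\<^sub>v (C\<^sup>T *\<^sub>v v)) = poly_mat g M *\<^sub>v v"
    by (simp add: H_def)
  define h where "h = poly_mat g H *\<^sub>v (C\<^sup>T *\<^sub>v v)"
  have h: "h \<in> carrier_vec k"
    unfolding h_def by (rule mult_mat_vec_carrier[OF poly_mat_carrier[OF H] Cv])
  have Ch: "C *\<^sub>v h \<in> carrier_vec n" "M *\<^sub>v (C *\<^sub>v h) \<in> carrier_vec n" using Q M h by auto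
  have "H *\<^sub>v h = C\<^sup>T *\<^sub>v (M *\<^sub>v (C *\<^sub>v h))"
    unfolding H_def using assoc_mult_mat_vec[of "C\<^sup>T * M" k n C k h] assoc_mult_mat_vec[of "C\<^sup>T" k n M n "C *\<^sub>v h"]
      Q M h Ch by simp
  hence "poly_mat (pCons a g) H *\<^sub>v (C\<^sup>T *\<^sub>v v) = a \<cdot>\<^sub>v (C\<^sup>T *\<^sub>v v) + C\<^sup>T *\<^sub>v (M *\<^sub>v (C *\<^sub>v h))"
    using step[OF H Cv] by (simp add: h_def)
  also have "\<dots> = C\<^sup>T *\<^sub>v (a \<cdot>\<^sub>v v + M *\<^sub>v (C *\<^sub>v h))"
    using Q v Ch mult_add_distrib_mat_vec[of "C\<^sup>T" k n "a \<cdot>\<^sub>v v" "M *\<^sub>v (C *\<^sub>v h)"] mult_mat_vec[of "C\<^sup>T" k n v a]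
    by simp
  also have "a \<cdot>\<^sub>v v + M *\<^sub>v (C *\<^sub>v h) = poly_mat (pCons a g) M *\<^sub>v v"
    using step[OF M v] IH by (simp add: h_def)
  finally show ?case using proj[OF pCons.prems] by (simp add: H_def)
qed

section \<open>Singular values as bounds on the stretching of vectors\<close>

lemma is_compact_svdD:
  assumes "is_compact_svd A r U s V" "A \<in> carrier_mat m n"
  shows "U \<in> carrier_mat m r" "U\<^sup>T * U = 1\<^sub>m r" "V \<in> carrier_mat n r" "V\<^sup>T * V = 1\<^sub>m r"
    "\<And>i. i < r \<Longrightarrow> 0 < s i" "\<And>i j. i \<le> j \<Longrightarrow> j < r \<Longrightarrow> s j \<le> s i" "A = U * mat_diag r s * V\<^sup>T"
  using assms by (auto simp: is_compact_svd_def)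

lemma compact_svd_mult_vec:
  assumes svd: "is_compact_svd A r U s V" and A: "A \<in> carrier_mat m n" and x: "x \<in> carrier_vec n"
  shows "A *\<^sub>v x = U *\<^sub>v (mat_diag r s *\<^sub>v (V\<^sup>T *\<^sub>v x))"
proof -
  note S = is_compact_svdD[OF svd A]
  have "A *\<^sub>v x = U * mat_diag r s * V\<^sup>T *\<^sub>v x" using S(7) by simp
  also have "\<dots> = U * mat_diag r s *\<^sub>v (V\<^sup>T *\<^sub>v x)"
    using S(1,3) x by (intro assoc_mult_mat_vec[of _ m r _ n]) auto
  also have "\<dots> = U *\<^sub>v (mat_diag r s *\<^sub>v (V\<^sup>T *\<^sub>v x))"
    using S(1,3) x by (intro assoc_mult_mat_vec[of _ m r _ r]) auto
  finally show ?thesis .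
qed

lemma norm2_compact_svd_mult_vec:
  assumes svd: "is_compact_svd A r U s V" and A: "A \<in> carrier_mat m n" and x: "x \<in> carrier_vec n"
  shows "norm2 (mat_diag r s *\<^sub>v (V\<^sup>T *\<^sub>v x)) = norm2 (A *\<^sub>v x)"
proof -
  note S = is_compact_svdD[OF svd A]
  have "mat_diag r s *\<^sub>v (V\<^sup>T *\<^sub>v x) \<in> carrier_vec r"
    by (rule mult_mat_vec_carrier[OF mat_diag_dim]) (use S(3) x in auto)
  from norm2_isometry[OF S(1,2) this] show ?thesis
    unfolding compact_svd_mult_vec[OF svd A x] by simp
qed

text \<open>In the coordinates \<open>V\<^sup>T *\<^sub>v x\<close>, \<open>A\<close> stretches the
  axes by the \<open>s i\<close>. The lower bound also needs that these coordinates lose none of the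
  norm of \<open>x\<close>: true at full column rank, where \<open>V\<close> is square; otherwise
  the \<open>n\<close>-th singular value is 0.\<close>

lemma sing_val_bounds:
  assumes A: "A \<in> carrier_mat m n" and x: "x \<in> carrier_vec n"
  shows "norm2 (A *\<^sub>v x) \<le> sing_val A 1 * norm2 x" "sing_val A n * norm2 x \<le> norm2 (A *\<^sub>v x)"
    "0 \<le> sing_val A j" "sing_val A (max m n) \<le> sing_val A n"
proof -
  obtain r U s V where c: "compact_svd A = (r, U, s, V)" by (cases "compact_svd A") auto
  note svd = is_compact_svd_compact_svd[OF c]
  note S = is_compact_svdD[OF svd A]
  have sv: "sing_val A j = (if 1 \<le> j \<and> j \<le> r then s (j - 1) else 0)" for j
    by (simp add: sing_val_def c)
  show nonneg: "0 \<le> sing_val A j" for j using S(5)[of "j - 1"] by (force simp: sv)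
  have Vx: "V\<^sup>T *\<^sub>v x \<in> carrier_vec r" using S(3) x by simp
  have "norm2 (A *\<^sub>v x) \<le> sing_val A 1 * norm2 (V\<^sup>T *\<^sub>v x)"
    unfolding norm2_compact_svd_mult_vec[OF svd A x, symmetric]
  proof (rule norm2_mat_diag_le[OF Vx _ nonneg])
    fix i assume "i < r"
    thus "\<bar>s i\<bar> \<le> sing_val A 1" using S(5)[of i] S(6)[of 0 i] by (simp add: sv)
  qed
  also have "\<dots> \<le> sing_val A 1 * norm2 x"
    by (rule mult_left_mono[OF norm2_transpose_le[OF S(3,4) x] nonneg])
  finally show "norm2 (A *\<^sub>v x) \<le> sing_val A 1 * norm2 x" .
  have rm: "r \<le> m" and rn: "r \<le> n"
    using orthonormal_columns_le[OF S(1,2)] orthonormal_columns_le[OF S(3,4)] by auto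
  show "sing_val A n * norm2 x \<le> norm2 (A *\<^sub>v x)"
  proof (cases "r = n")
    case True
    have "V * V\<^sup>T = 1\<^sub>m n"
      using S(3,4) True by (intro mat_mult_left_right_inverse[of "V\<^sup>T"]) auto
    hence "norm2 x = norm2 (V\<^sup>T *\<^sub>v x)"
      using S(3) x True norm2_isometry[of "V\<^sup>T" n n x] by simp
    moreover have "sing_val A n * norm2 (V\<^sup>T *\<^sub>v x) \<le> norm2 (mat_diag r s *\<^sub>v (V\<^sup>T *\<^sub>v x))"
    proof (rule norm2_mat_diag_ge[OF Vx _ nonneg])
      fix i assume "i < r"
      thus "sing_val A n \<le> s i" using S(6)[of i "n - 1"] True by (simp add: sv)
    qed
    ultimately show ?thesis by (simp add: norm2_compact_svd_mult_vec[OF svd A x])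
  next
    case False
    thus ?thesis using rn by (simp add: sv)
  qed
  show "sing_val A (max m n) \<le> sing_val A n"
  proof (cases "m \<le> n")
    case False
    \<comment> \<open>With more rows than columns the index exceeds the rank, and the convention
      makes the value 0.\<close>
    hence "sing_val A (max m n) = 0" using rn by (simp add: sv)
    thus ?thesis using nonneg[of n] by simp
  qed (simp add: max_absorb2)
qed

text \<open>The right singular vector \<open>V *\<^sub>v e\<close> is a unit vector stretched by
  exactly \<open>s i\<close>. With free \<open>lo\<close> and \<open>hi\<close> this also places the
  singular values of \<open>B\<close> between bounds taken from \<open>A\<close>.\<close>

lemma compact_svd_singular_value_bounds:
  assumes svd: "is_compact_svd A r U s V" and A: "A \<in> carrier_mat m n" and i: "i < r"
    and lo: "\<And>x. x \<in> carrier_vec n \<Longrightarrow> lo * norm2 x \<le> norm2 (A *\<^sub>v x)"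
    and hi: "\<And>x. x \<in> carrier_vec n \<Longrightarrow> norm2 (A *\<^sub>v x) \<le> hi * norm2 x"
  shows "s i \<in> {lo..hi}"
proof -
  note S = is_compact_svdD[OF svd A]
  define e where "e = (unit_vec r i :: real vec)"
  have e: "e \<in> carrier_vec r" "norm2 e = 1"
    using i by (auto simp: e_def norm2_def)
  have x: "V *\<^sub>v e \<in> carrier_vec n" "norm2 (V *\<^sub>v e) = 1"
    using S(3) e norm2_isometry[OF S(3,4) e(1)] by auto
  have "V\<^sup>T *\<^sub>v (V *\<^sub>v e) = V\<^sup>T * V *\<^sub>v e"
    by (rule assoc_mult_mat_vec[symmetric]) (use S(3) e in auto)
  also have "\<dots> = e" using e by (simp add: S(4))
  finally have Ve: "V\<^sup>T *\<^sub>v (V *\<^sub>v e) = e" .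
  have "mat_diag r s *\<^sub>v e = s i \<cdot>\<^sub>v e"
    using e i by (subst mat_diag_mult_vec) (auto simp: e_def intro!: eq_vecI)
  hence "norm2 (A *\<^sub>v (V *\<^sub>v e)) = norm2 (s i \<cdot>\<^sub>v e)"
    unfolding norm2_compact_svd_mult_vec[OF svd A x(1), symmetric] Ve by simp
  also have "\<dots> = s i * norm2 e"
    using S(5)[OF i] e(1) by (simp add: norm2_def real_sqrt_mult)
  finally have "norm2 (A *\<^sub>v (V *\<^sub>v e)) = s i" using e by simp
  thus ?thesis using lo[OF x(1)] hi[OF x(1)] x(2) by simp
qed

lemma cmat_mult:
  "X \<in> carrier_mat a b \<Longrightarrow> Y \<in> carrier_mat b c \<Longrightarrow> cmat (X * Y) = cmat X * cmat Y"
  by (rule of_real_hom.mat_hom_mult)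

text \<open>\<open>V\<^sup>T\<close> turns \<open>A\<^sup>T * A\<close> into the diagonal matrix of
  squared singular values, which reduces the claim to scalars. Since \<open>R\<close> enters only
  through its product with \<open>q\<close>, a root of \<open>q\<close> at a squared singular value
  is harmless if \<open>p\<close> vanishes there too.\<close>

lemma compact_svd_rational:
  assumes svd: "is_compact_svd A r U s V" and A: "A \<in> carrier_mat m n" and x: "x \<in> carrier_vec n"
    and R: "\<And>i. i < r \<Longrightarrow> R i * poly q (complex_of_real ((s i)\<^sup>2)) = poly p (complex_of_real ((s i)\<^sup>2))"
  shows "cmat U *\<^sub>v (mat_diag r (\<lambda>i. R i * complex_of_real (s i)) *\<^sub>v
        ((cmat V)\<^sup>T *\<^sub>v (poly_mat q (cmat (A\<^sup>T * A)) *\<^sub>v x)))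
    = cmat A *\<^sub>v (poly_mat p (cmat (A\<^sup>T * A)) *\<^sub>v x)"
proof -
  note S = is_compact_svdD[OF svd A]
  define M where "M = cmat (A\<^sup>T * A)"
  define W where "W = (cmat V)\<^sup>T"
  define D where "D = mat_diag r (\<lambda>i. complex_of_real ((s i)\<^sup>2))"
  have C: "M \<in> carrier_mat n n" "W \<in> carrier_mat r n" "D \<in> carrier_mat r r" "cmat U \<in> carrier_mat m r"
    using A S by (auto simp: M_def W_def D_def)
  have cd: "cmat (mat_diag r h) = mat_diag r (\<lambda>i. complex_of_real (h i))" for h
    by (auto simp: mat_diag_def intro!: eq_matI)
  have DT: "(mat_diag r s)\<^sup>T = mat_diag r s"
    by (auto simp: mat_diag_def intro!: eq_matI)
  have AT: "A\<^sup>T = V * (mat_diag r s * U\<^sup>T)"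
  proof -
    have "A\<^sup>T = (V\<^sup>T)\<^sup>T * (U * mat_diag r s)\<^sup>T"
      unfolding S(7) by (rule transpose_mult[OF mult_carrier_mat[OF S(1) mat_diag_dim]]) (use S(3) in simp)
    also have "(U * mat_diag r s)\<^sup>T = mat_diag r s * U\<^sup>T"
      unfolding transpose_mult[OF S(1) mat_diag_dim] DT ..
    finally show ?thesis by simp
  qed
  have "V\<^sup>T * (A\<^sup>T * A) = mat_diag r (\<lambda>i. (s i)\<^sup>2) * V\<^sup>T"
  proof -
    have Vt: "V\<^sup>T \<in> carrier_mat r n" and Ut: "U\<^sup>T \<in> carrier_mat r m" using S by auto
    have SU: "mat_diag r s * U\<^sup>T \<in> carrier_mat r m" using Ut by (intro mult_carrier_mat) auto
    have US: "U * mat_diag r s \<in> carrier_mat m r" using S(1) by (intro mult_carrier_mat) auto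
    have SV: "mat_diag r s * V\<^sup>T \<in> carrier_mat r n" using Vt by (intro mult_carrier_mat) auto
    have "V\<^sup>T * (A\<^sup>T * A) = V\<^sup>T * A\<^sup>T * A"
      by (rule assoc_mult_mat[symmetric, of _ r n _ m _ n]) (use A Vt in auto)
    also have "V\<^sup>T * A\<^sup>T = V\<^sup>T * V * (mat_diag r s * U\<^sup>T)"
      unfolding AT by (rule assoc_mult_mat[OF Vt S(3) SU, symmetric])
    also have "\<dots> = mat_diag r s * U\<^sup>T"
      unfolding S(4) by (rule left_mult_one_mat[OF SU])
    also have "\<dots> * A = mat_diag r s * (U\<^sup>T * A)"
      by (rule assoc_mult_mat[OF mat_diag_dim Ut A])
    also have "U\<^sup>T * A = U\<^sup>T * (U * (mat_diag r s * V\<^sup>T))"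
      using S(7) assoc_mult_mat[OF S(1) mat_diag_dim Vt, of s] by simp
    also have "\<dots> = U\<^sup>T * U * (mat_diag r s * V\<^sup>T)"
      by (rule assoc_mult_mat[OF Ut S(1) SV, symmetric])
    also have "\<dots> = mat_diag r s * V\<^sup>T"
      unfolding S(2) by (rule left_mult_one_mat[OF SV])
    also have "mat_diag r s * \<dots> = mat_diag r s * mat_diag r s * V\<^sup>T"
      by (rule assoc_mult_mat[OF mat_diag_dim mat_diag_dim Vt, symmetric])
    finally show ?thesis by (simp add: power2_eq_square)
  qed
  hence "cmat (V\<^sup>T * (A\<^sup>T * A)) = cmat (mat_diag r (\<lambda>i. (s i)\<^sup>2) * V\<^sup>T)" by simp
  hence "W * M = D * W"
    using cmat_mult[of "V\<^sup>T" r n "A\<^sup>T * A" n] cmat_mult[OF mat_diag_dim, of "V\<^sup>T" r n "\<lambda>i. (s i)\<^sup>2"] A S(3)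
    by (simp add: W_def M_def D_def cd map_mat_transpose)
  note WM = poly_mat_intertwine[OF C(2,1,3) this]
  have Wx: "W *\<^sub>v (poly_mat g M *\<^sub>v x) = mat_diag r (\<lambda>i. poly g (complex_of_real ((s i)\<^sup>2))) *\<^sub>v (W *\<^sub>v x)" for g
    using assoc_mult_mat_vec[OF C(2) poly_mat_carrier[OF C(1)] x, of g]
      assoc_mult_mat_vec[OF poly_mat_carrier[OF C(3)] C(2) x, of g] WM[of g]
    by (simp add: D_def poly_mat_mat_diag)
  have Wxc: "W *\<^sub>v x \<in> carrier_vec r" by (rule mult_mat_vec_carrier[OF C(2) x])
  define gx where "gx = poly_mat p M *\<^sub>v x"
  have gx: "gx \<in> carrier_vec n" unfolding gx_def by (rule mult_mat_vec_carrier[OF poly_mat_carrier[OF C(1)] x])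
  have dd: "mat_diag r h *\<^sub>v (mat_diag r h' *\<^sub>v (W *\<^sub>v x)) = mat_diag r (\<lambda>i. h i * h' i) *\<^sub>v (W *\<^sub>v x)"
    for h h' :: "nat \<Rightarrow> complex"
    unfolding mat_diag_diag[symmetric] by (rule assoc_mult_mat_vec[OF mat_diag_dim mat_diag_dim Wxc, symmetric])
  have "cmat A = cmat U * mat_diag r (\<lambda>i. complex_of_real (s i)) * W"
    using S(7) cmat_mult[of "U * mat_diag r s" m r "V\<^sup>T" n] cmat_mult[OF S(1) mat_diag_dim, of s] S(1,3)
    by (simp add: cd W_def map_mat_transpose del: assoc_mult_mat)
  hence "cmat A *\<^sub>v gx = cmat U *\<^sub>v (mat_diag r (\<lambda>i. complex_of_real (s i)) *\<^sub>v (W *\<^sub>v gx))"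
    using assoc_mult_mat_vec[OF mult_carrier_mat[OF C(4) mat_diag_dim] C(2) gx]
      assoc_mult_mat_vec[OF C(4) mat_diag_dim mult_mat_vec_carrier[OF C(2) gx]] by simp
  also have "\<dots> = cmat U *\<^sub>v (mat_diag r (\<lambda>i. complex_of_real (s i) * poly p (complex_of_real ((s i)\<^sup>2))) *\<^sub>v (W *\<^sub>v x))"
    unfolding gx_def Wx dd ..
  also have "mat_diag r (\<lambda>i. complex_of_real (s i) * poly p (complex_of_real ((s i)\<^sup>2))) =
      mat_diag r (\<lambda>i. R i * complex_of_real (s i) * poly q (complex_of_real ((s i)\<^sup>2)))"
    using R by (auto simp: mat_diag_def mult.commute mult.left_commute intro!: eq_matI)
  also have "\<dots> *\<^sub>v (W *\<^sub>v x) =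
      mat_diag r (\<lambda>i. R i * complex_of_real (s i)) *\<^sub>v (W *\<^sub>v (poly_mat q M *\<^sub>v x))"
    unfolding Wx dd ..
  finally show ?thesis by (simp add: W_def M_def gx_def)
qed

section \<open>Real parts, and exactness for rational functions\<close>

lemma Re_mult_vec:
  assumes "X \<in> carrier_mat a b" "v \<in> carrier_vec b"
  shows "map_vec Re (cmat X *\<^sub>v v) = X *\<^sub>v map_vec Re v"
  using assms by (intro eq_vecI) (auto simp: scalar_prod_def)

lemma Re_diag_mult_vec:
  assumes "x \<in> carrier_vec r"
  shows "map_vec Re (mat_diag r h *\<^sub>v cvec x) = mat_diag r (\<lambda>i. Re (h i)) *\<^sub>v x"
  using assms by (subst (1 2) mat_diag_mult_vec) (auto intro!: eq_vecI)

lemma degree_pole_poly: "degree (pole_poly \<xi> k) \<le> k - 1"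
proof -
  have "degree (pole_poly \<xi> k) \<le> (\<Sum>j\<in>{1..k - 1}. 1)"
    unfolding pole_poly_def
    by (rule order_trans[OF degree_prod_sum_le]) (simp, intro sum_mono, auto split: option.splits)
  thus ?thesis by simp
qed

text \<open>The relation for the reduced fraction multiplied by the gcd, hence valid also where the
  gcd vanishes.\<close>

lemma ratfun_val_times_denominator:
  assumes "ratfun_val p q w = Some y"
  shows "y * poly q w = poly p w"
proof -
  define g p' q' where "g = gcd p q" and "p' = p div g" and "q' = q div g"
  have "poly q' w \<noteq> 0" "y = poly p' w / poly q' w"
    using assms by (auto simp: ratfun_val_def Let_def g_def p'_def q'_def split: if_splits)
  moreover have "p = p' * g" "q = q' * g" by (simp_all add: g_def p'_def q'_def)
  ultimately show ?thesis by (metis nonzero_eq_divide_eq mult.assoc poly_mult)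
qed

lemma rational_krylov_exact:
  fixes A P Q B :: "real mat" and R :: "real \<Rightarrow> complex"
  assumes A: "A \<in> carrier_mat m n" and b: "b \<in> carrier_vec n" and k: "1 \<le> k"
    and poles: "\<And>j c. 1 \<le> j \<Longrightarrow> j \<le> k - 1 \<Longrightarrow> \<xi> j = Some c \<Longrightarrow>
        \<not> eigenvalue (cmat (A\<^sup>T * A)) c \<and> \<not> eigenvalue (cmat (A * A\<^sup>T)) c"
    and q: "q = pole_poly \<xi> k"
    and Q: "real_onb n k Q (rat_krylov q k (cmat (A\<^sup>T * A)) (cvec b))"
    and P: "real_onb m k P (rat_krylov q k (cmat (A * A\<^sup>T)) (cvec (A *\<^sub>v b)))"
    and B: "B = P\<^sup>T * A * Q"
    and svdA: "is_compact_svd A r U s V" and svdB: "is_compact_svd B r' U' s' V'"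
  shows "Q *\<^sub>v (Q\<^sup>T *\<^sub>v b) = b"
    and "\<And>x. x \<in> carrier_vec k \<Longrightarrow> P *\<^sub>v (B *\<^sub>v x) = A *\<^sub>v (Q *\<^sub>v x)"
    and "\<lbrakk>degree p \<le> k - 1; \<And>i. i < r \<Longrightarrow> ratfun_val p q (complex_of_real ((s i)\<^sup>2)) = Some (R (s i));
          \<And>i. i < r' \<Longrightarrow> ratfun_val p q (complex_of_real ((s' i)\<^sup>2)) = Some (R (s' i))\<rbrakk> \<Longrightarrow>
      U *\<^sub>v (mat_diag r (\<lambda>i. Re (R (s i) * complex_of_real (s i))) *\<^sub>v (V\<^sup>T *\<^sub>v b)) =
      P *\<^sub>v (U' *\<^sub>v (mat_diag r' (\<lambda>i. Re (R (s' i) * complex_of_real (s' i))) *\<^sub>v (V'\<^sup>T *\<^sub>v (Q\<^sup>T *\<^sub>v b))))"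
proof -
  have Pc: "P \<in> carrier_mat m k" "P\<^sup>T * P = 1\<^sub>m k" and Qc: "Q \<in> carrier_mat n k" "Q\<^sup>T * Q = 1\<^sub>m k"
    using P Q by (auto simp: real_onb_def)
  have Bc: "B \<in> carrier_mat k k" using A Pc Qc by (simp add: B)
  have PtA: "P\<^sup>T * A \<in> carrier_mat k n" using A Pc by (intro mult_carrier_mat[of _ k m]) auto
  have AQ: "A * Q \<in> carrier_mat m k" by (rule mult_carrier_mat[OF A Qc(1)])
  have PB: "P * B = A * Q"
  proof -
    have "P * B = P * (P\<^sup>T * (A * Q))"
      unfolding B using assoc_mult_mat[of "P\<^sup>T" k m A n Q k] A Pc Qc by simp
    also have "\<dots> = P * P\<^sup>T * (A * Q)"
      by (rule assoc_mult_mat[symmetric, of _ m k _ m _ k]) (use Pc AQ in auto)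
    also have "\<dots> = A * Q" by (rule rat_krylov_image[OF A b poles q Q P])
    finally show ?thesis .
  qed
  show PBx: "P *\<^sub>v (B *\<^sub>v x) = A *\<^sub>v (Q *\<^sub>v x)" if "x \<in> carrier_vec k" for x
    using assoc_mult_mat_vec[OF Pc(1) Bc that] assoc_mult_mat_vec[OF A Qc(1) that] PB by simp
  define M where "M = cmat (A\<^sup>T * A)"
  define G where "G = the (mat_inverse (poly_mat q M))"
  define C where "C = cmat Q"
  have M: "M \<in> carrier_mat n n" using A by (simp add: M_def)
  have C: "C \<in> carrier_mat n k" using Qc by (simp add: C_def)
  have Ct: "C\<^sup>T = cmat (Q\<^sup>T)" by (simp add: C_def map_mat_transpose)
  have CC: "C\<^sup>T * C = 1\<^sub>m k"
    unfolding Ct using cmat_mult[of "Q\<^sup>T" k n Q k] Qc by (simp add: C_def of_real_hom.mat_hom_one)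
  have G: "G \<in> carrier_mat n n" "poly_mat q M * G = 1\<^sub>m n" "G * poly_mat q M = 1\<^sub>m n"
    unfolding q using poles by (intro mat_inverse_pole_poly[OF M _ G_def[unfolded q]]; auto simp: M_def)+
  have cb: "cvec b \<in> carrier_vec n" using b by simp
  define v where "v = G *\<^sub>v cvec b"
  have v: "v \<in> carrier_vec n" unfolding v_def by (rule mult_mat_vec_carrier[OF G(1) cb])
  have qv: "poly_mat q M *\<^sub>v v = cvec b"
    using assoc_mult_mat_vec[OF poly_mat_carrier[OF M] G(1) cb, of q] cb by (simp add: G(2) v_def)
  have proj: "C *\<^sub>v (C\<^sup>T *\<^sub>v (poly_mat g M *\<^sub>v v)) = poly_mat g M *\<^sub>v v" if "degree g < k" for g
    unfolding C_def v_def
    by (rule rat_krylov_contains[OF M cb Q[folded M_def] G_def G that])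
  have degq: "degree q < k" using degree_pole_poly[of \<xi> k] k by (simp add: q)
  have Qtb: "C\<^sup>T *\<^sub>v cvec b = cvec (Q\<^sup>T *\<^sub>v b)"
    unfolding Ct by (rule of_real_hom.mult_mat_vec_hom[symmetric]) (use Qc b in auto)
  have Qtbc: "Q\<^sup>T *\<^sub>v b \<in> carrier_vec k" using Qc b by simp
  \<comment> \<open>\<open>b\<close> is \<open>q(M)\<close> applied to \<open>v\<close>, and
    \<open>q\<close> has degree below \<open>k\<close>, so \<open>b\<close> itself lies in the first
    Krylov space.\<close>
  have "cvec (Q *\<^sub>v (Q\<^sup>T *\<^sub>v b)) = cvec b"
    unfolding of_real_hom.mult_mat_vec_hom[OF Qc(1) Qtbc] C_def[symmetric]
    using proj[OF degq] by (simp only: qv Qtb)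
  thus "Q *\<^sub>v (Q\<^sup>T *\<^sub>v b) = b" by (rule of_real_hom.vec_hom_inj)
  define w where "w = C\<^sup>T *\<^sub>v v"
  have w: "w \<in> carrier_vec k" using C v by (simp add: w_def)
  have H: "C\<^sup>T * M * C = cmat (B\<^sup>T * B)"
  proof -
    have "B\<^sup>T * B = Q\<^sup>T * (P\<^sup>T * A)\<^sup>T * B"
      using transpose_mult[OF PtA Qc(1)] by (simp add: B)
    also have "(P\<^sup>T * A)\<^sup>T = A\<^sup>T * P" using transpose_mult[of "P\<^sup>T" k m A n] A Pc by simp
    also have "Q\<^sup>T * (A\<^sup>T * P) * B = Q\<^sup>T * (A\<^sup>T * P * B)"
      by (rule assoc_mult_mat[of _ k n _ k _ k]) (use A Pc Qc Bc in auto)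
    also have "A\<^sup>T * P * B = A\<^sup>T * (P * B)"
      by (rule assoc_mult_mat[of _ n m _ k _ k]) (use A Pc Bc in auto)
    also have "\<dots> = A\<^sup>T * A * Q"
      unfolding PB by (rule assoc_mult_mat[symmetric, of _ n m _ n _ k]) (use A Qc in auto)
    finally have "B\<^sup>T * B = Q\<^sup>T * (A\<^sup>T * A * Q)" .
    also have "cmat \<dots> = C\<^sup>T * cmat (A\<^sup>T * A * Q)"
      unfolding Ct by (rule cmat_mult) (use A Qc in auto)
    also have "cmat (A\<^sup>T * A * Q) = M * C"
      unfolding M_def C_def by (rule cmat_mult) (use A Qc in auto)
    also have "C\<^sup>T * (M * C) = C\<^sup>T * M * C"
      by (rule assoc_mult_mat[symmetric, of _ k n _ n _ k]) (use M C in auto)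
    finally show ?thesis by simp
  qed
  define H where "H = cmat (B\<^sup>T * B)"
  have Hc: "H \<in> carrier_mat k k" using Bc by (simp add: H_def)
  have exact: "C *\<^sub>v (poly_mat g H *\<^sub>v w) = poly_mat g M *\<^sub>v v" if "degree g < k" for g
    using krylov_poly_exact[OF M v C proj that] by (simp only: H H_def w_def)
  \<comment> \<open>Exactness for \<open>q\<close> says that \<open>C\<close> maps
    \<open>q(H) * w\<close> to \<open>b\<close>; cancelling \<open>C\<close> shows that
    \<open>w\<close> relates to \<open>B\<close> and \<open>Q\<^sup>T * b\<close> as
    \<open>v\<close> does to \<open>A\<close> and \<open>b\<close>.\<close>
  have "C\<^sup>T *\<^sub>v (C *\<^sub>v (poly_mat q H *\<^sub>v w)) = C\<^sup>T * C *\<^sub>v (poly_mat q H *\<^sub>v w)"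
    by (rule assoc_mult_mat_vec[symmetric, OF _ C mult_mat_vec_carrier[OF poly_mat_carrier[OF Hc] w]])
      (use C in simp)
  hence qw: "poly_mat q H *\<^sub>v w = cvec (Q\<^sup>T *\<^sub>v b)"
    using one_mult_mat_vec[OF mult_mat_vec_carrier[OF poly_mat_carrier[OF Hc] w]]
    by (simp add: exact[OF degq] qv Qtb CC)
  assume p: "degree p \<le> k - 1"
    and R: "\<And>i. i < r \<Longrightarrow> ratfun_val p q (complex_of_real ((s i)\<^sup>2)) = Some (R (s i))"
    and R': "\<And>i. i < r' \<Longrightarrow> ratfun_val p q (complex_of_real ((s' i)\<^sup>2)) = Some (R (s' i))"
  have degp: "degree p < k" using p k by simp
  define \<rho> where "\<rho> z = R z * complex_of_real z" for z
  note SA = is_compact_svdD[OF svdA A]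
  note SB = is_compact_svdD[OF svdB Bc]
  have Vb: "V\<^sup>T *\<^sub>v b \<in> carrier_vec r" "V'\<^sup>T *\<^sub>v (Q\<^sup>T *\<^sub>v b) \<in> carrier_vec r'"
    using SA(3) SB(3) b Qtbc by auto
  have cVb: "(cmat V)\<^sup>T *\<^sub>v cvec b = cvec (V\<^sup>T *\<^sub>v b)"
    "(cmat V')\<^sup>T *\<^sub>v cvec (Q\<^sup>T *\<^sub>v b) = cvec (V'\<^sup>T *\<^sub>v (Q\<^sup>T *\<^sub>v b))"
    unfolding map_mat_transpose
    by (rule of_real_hom.mult_mat_vec_hom[symmetric], use SA(3) SB(3) b Qtbc in auto)+
  have eA: "cmat U *\<^sub>v (mat_diag r (\<lambda>i. \<rho> (s i)) *\<^sub>v cvec (V\<^sup>T *\<^sub>v b)) = cmat A *\<^sub>v (poly_mat p M *\<^sub>v v)"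
    using compact_svd_rational[OF svdA A v, where p = p and q = q and R = "\<lambda>i. R (s i)",
        OF ratfun_val_times_denominator[OF R]]
    unfolding M_def[symmetric] qv cVb \<rho>_def by simp
  have eB: "cmat U' *\<^sub>v (mat_diag r' (\<lambda>i. \<rho> (s' i)) *\<^sub>v cvec (V'\<^sup>T *\<^sub>v (Q\<^sup>T *\<^sub>v b)))
      = cmat B *\<^sub>v (poly_mat p H *\<^sub>v w)"
    using compact_svd_rational[OF svdB Bc w, where p = p and q = q and R = "\<lambda>i. R (s' i)",
        OF ratfun_val_times_denominator[OF R']]
    unfolding H_def[symmetric] qw cVb \<rho>_def by simp
  have pw: "poly_mat p H *\<^sub>v w \<in> carrier_vec k"
    by (rule mult_mat_vec_carrier[OF poly_mat_carrier[OF Hc] w])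
  have "cmat P *\<^sub>v (cmat B *\<^sub>v (poly_mat p H *\<^sub>v w)) = cmat P * cmat B *\<^sub>v (poly_mat p H *\<^sub>v w)"
    by (rule assoc_mult_mat_vec[symmetric, OF _ _ pw]) (use Pc Bc in auto)
  also have "cmat P * cmat B = cmat A * C"
    unfolding C_def using cmat_mult[OF Pc(1) Bc] cmat_mult[OF A Qc(1)] PB by simp
  also have "\<dots> *\<^sub>v (poly_mat p H *\<^sub>v w) = cmat A *\<^sub>v (C *\<^sub>v (poly_mat p H *\<^sub>v w))"
    by (rule assoc_mult_mat_vec[OF _ C pw]) (use A in simp)
  also have "\<dots> = cmat A *\<^sub>v (poly_mat p M *\<^sub>v v)" unfolding exact[OF degp] ..
  finally have eq: "cmat U *\<^sub>v (mat_diag r (\<lambda>i. \<rho> (s i)) *\<^sub>v cvec (V\<^sup>T *\<^sub>v b)) =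
      cmat P *\<^sub>v (cmat U' *\<^sub>v (mat_diag r' (\<lambda>i. \<rho> (s' i)) *\<^sub>v cvec (V'\<^sup>T *\<^sub>v (Q\<^sup>T *\<^sub>v b))))"
    unfolding eA eB by simp
  have dA: "mat_diag r (\<lambda>i. \<rho> (s i)) *\<^sub>v cvec (V\<^sup>T *\<^sub>v b) \<in> carrier_vec r"
    by (rule mult_mat_vec_carrier[OF mat_diag_dim]) (use Vb in simp)
  have dB: "mat_diag r' (\<lambda>i. \<rho> (s' i)) *\<^sub>v cvec (V'\<^sup>T *\<^sub>v (Q\<^sup>T *\<^sub>v b)) \<in> carrier_vec r'"
    by (rule mult_mat_vec_carrier[OF mat_diag_dim]) (use Vb in simp)
  have U'c: "cmat U' *\<^sub>v (mat_diag r' (\<lambda>i. \<rho> (s' i)) *\<^sub>v cvec (V'\<^sup>T *\<^sub>v (Q\<^sup>T *\<^sub>v b))) \<in> carrier_vec k"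
    by (rule mult_mat_vec_carrier[OF _ dB]) (use SB(1) in simp)
  show "U *\<^sub>v (mat_diag r (\<lambda>i. Re (R (s i) * complex_of_real (s i))) *\<^sub>v (V\<^sup>T *\<^sub>v b)) =
      P *\<^sub>v (U' *\<^sub>v (mat_diag r' (\<lambda>i. Re (R (s' i) * complex_of_real (s' i))) *\<^sub>v (V'\<^sup>T *\<^sub>v (Q\<^sup>T *\<^sub>v b))))"
    \<comment> \<open>Every factor of \<open>eq\<close> except the values of \<open>\<rho>\<close>
      is real, so taking real parts affects the diagonals only.\<close>
    using arg_cong[OF eq, of "map_vec Re"]
    unfolding Re_mult_vec[OF SA(1) dA] Re_mult_vec[OF Pc(1) U'c] Re_mult_vec[OF SB(1) dB]
      Re_diag_mult_vec[OF Vb(1)] Re_diag_mult_vec[OF Vb(2)]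
    unfolding \<rho>_def .
qed

section \<open>Error bounds\<close>

lemma compact_svd_error_split:
  fixes U U' P :: "real mat" and f \<rho> :: "real \<Rightarrow> real"
  assumes U: "U \<in> carrier_mat m r" "U\<^sup>T * U = 1\<^sub>m r" and U': "U' \<in> carrier_mat k r'" "U'\<^sup>T * U' = 1\<^sub>m r'"
    and P: "P \<in> carrier_mat m k" "P\<^sup>T * P = 1\<^sub>m k" and x: "x \<in> carrier_vec r" and y: "y \<in> carrier_vec r'"
    and eq: "U *\<^sub>v (mat_diag r (\<lambda>i. \<rho> (s i)) *\<^sub>v x) = P *\<^sub>v (U' *\<^sub>v (mat_diag r' (\<lambda>i. \<rho> (s' i)) *\<^sub>v y))"
  shows "norm2 (U *\<^sub>v (mat_diag r (\<lambda>i. f (s i)) *\<^sub>v x) - P *\<^sub>v (U' *\<^sub>v (mat_diag r' (\<lambda>i. f (s' i)) *\<^sub>v y)))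
    \<le> norm2 (mat_diag r (\<lambda>i. f (s i) - \<rho> (s i)) *\<^sub>v x) + norm2 (mat_diag r' (\<lambda>i. f (s' i) - \<rho> (s' i)) *\<^sub>v y)"
proof -
  define D where "D = (\<lambda>h :: real \<Rightarrow> real. mat_diag r (\<lambda>i. h (s i)) *\<^sub>v x)"
  define E where "E = (\<lambda>h :: real \<Rightarrow> real. mat_diag r' (\<lambda>i. h (s' i)) *\<^sub>v y)"
  define g where "g z = f z - \<rho> z" for z
  have DE: "D h \<in> carrier_vec r" "E h \<in> carrier_vec r'" for h
    unfolding D_def E_def by (rule mult_mat_vec_carrier[OF mat_diag_dim x], rule mult_mat_vec_carrier[OF mat_diag_dim y])
  have D: "D f = D g + D \<rho>" and E: "E f = E g + E \<rho>"
    unfolding D_def E_def mat_diag_mult_vec[OF x] mat_diag_mult_vec[OF y]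
    by (auto simp: g_def algebra_simps intro!: eq_vecI)
  have C: "U *\<^sub>v D h \<in> carrier_vec m" "U' *\<^sub>v E h \<in> carrier_vec k" "P *\<^sub>v (U' *\<^sub>v E h) \<in> carrier_vec m" for h
    using mult_mat_vec_carrier[OF U(1) DE(1)] mult_mat_vec_carrier[OF U'(1) DE(2)] mult_mat_vec_carrier[OF P(1)]
    by auto
  have "U *\<^sub>v D f = U *\<^sub>v D g + U *\<^sub>v D \<rho>"
    unfolding D by (rule mult_add_distrib_mat_vec[OF U(1) DE(1) DE(1)])
  moreover have "P *\<^sub>v (U' *\<^sub>v E f) = P *\<^sub>v (U' *\<^sub>v E g) + P *\<^sub>v (U' *\<^sub>v E \<rho>)"
    unfolding E mult_add_distrib_mat_vec[OF U'(1) DE(2) DE(2)]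
    by (rule mult_add_distrib_mat_vec[OF P(1) C(2) C(2)])
  moreover have "U *\<^sub>v D \<rho> = P *\<^sub>v (U' *\<^sub>v E \<rho>)" using eq by (simp only: D_def E_def)
  ultimately have "U *\<^sub>v D f - P *\<^sub>v (U' *\<^sub>v E f) = U *\<^sub>v D g - P *\<^sub>v (U' *\<^sub>v E g)"
    using C(1)[of g] C(1)[of \<rho>] C(3)[of g] C(3)[of \<rho>] by (intro eq_vecI) auto
  hence "norm2 (U *\<^sub>v D f - P *\<^sub>v (U' *\<^sub>v E f)) \<le> norm2 (U *\<^sub>v D g) + norm2 (P *\<^sub>v (U' *\<^sub>v E g))"
    using norm2_minus_le[OF C(1) C(3)] by simp
  also have "\<dots> = norm2 (D g) + norm2 (E g)"
    using norm2_isometry[OF U DE(1)] norm2_isometry[OF P C(2)] norm2_isometry[OF U' DE(2)] by simp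
  finally show ?thesis by (simp only: D_def E_def g_def)
qed

text \<open>A finite bound excludes the infinite values that stand for poles, so the function is
  defined on all of \<open>I\<close>.\<close>

lemma sup_norm_le_iff:
  assumes "0 \<le> C"
  shows "sup_norm I h \<le> ennreal C \<longleftrightarrow> (\<forall>z\<in>I. \<exists>y. h z = Some y \<and> cmod y \<le> C)"
  using assms by (fastforce simp: sup_norm_def SUP_le_iff top_unique split: option.splits)

lemma gen_mat_fun_mult_vec:
  assumes c: "compact_svd A = (r, U, s, V)" and A: "A \<in> carrier_mat m n" and x: "x \<in> carrier_vec n"
  shows "gen_mat_fun f A *\<^sub>v x = U *\<^sub>v (mat_diag r (\<lambda>i. f (s i)) *\<^sub>v (V\<^sup>T *\<^sub>v x))"
proof -
  note S = is_compact_svdD[OF is_compact_svd_compact_svd[OF c] A]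
  have Vx: "V\<^sup>T *\<^sub>v x \<in> carrier_vec r" using S(3) x by simp
  have "gen_mat_fun f A *\<^sub>v x = U * mat_diag r (\<lambda>i. f (s i)) *\<^sub>v (V\<^sup>T *\<^sub>v x)"
    unfolding gen_mat_fun_def c prod.case
    by (rule assoc_mult_mat_vec[OF mult_carrier_mat[OF S(1) mat_diag_dim] _ x]) (use S(3) in simp)
  also have "\<dots> = U *\<^sub>v (mat_diag r (\<lambda>i. f (s i)) *\<^sub>v (V\<^sup>T *\<^sub>v x))"
    by (rule assoc_mult_mat_vec[OF S(1) mat_diag_dim Vx])
  finally show ?thesis .
qed

text \<open>The bounds live in \<open>ennreal\<close> because a remaining pole makes the norm
  infinite, and \<open>is_arg_min\<close> expresses that the minimum is attained. The estimate
  itself is proved for every admissible numerator. Numerators are complex, and their minimum is at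
  most the one over real polynomials.\<close>

theorem theorem6p7:
  fixes A P Q B :: "real mat" and b y :: "real vec" and f :: "real \<Rightarrow> real"
    and \<xi> :: "nat \<Rightarrow> complex option" and q :: "complex poly" and m n k :: nat
  assumes A: "A \<in> carrier_mat m n" and b: "b \<in> carrier_vec n" and k: "1 \<le> k"
    and f0: "f 0 = 0"
    and poles: "\<And>j c. 1 \<le> j \<Longrightarrow> j \<le> k - 1 \<Longrightarrow> \<xi> j = Some c \<Longrightarrow>
        \<not> eigenvalue (cmat (A\<^sup>T * A)) c \<and> \<not> eigenvalue (cmat (A * A\<^sup>T)) c"
    and q: "q = pole_poly \<xi> k"
    and Q: "real_onb n k Q (rat_krylov q k (cmat (A\<^sup>T * A)) (cvec b))"
    and P: "real_onb m k P (rat_krylov q k (cmat (A * A\<^sup>T)) (cvec (A *\<^sub>v b)))"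
    and B: "B = P\<^sup>T * A * Q"
    and y: "y = P *\<^sub>v (gen_mat_fun f B *\<^sub>v (Q\<^sup>T *\<^sub>v b))"
  shows "(\<exists>p. is_arg_min (err_norm f q {sing_val A n..sing_val A 1}) (\<lambda>p. degree p \<le> k - 1) p \<and>
           ennreal (norm2 (gen_mat_fun f A *\<^sub>v b - y))
             \<le> ennreal (2 * norm2 b) * err_norm f q {sing_val A n..sing_val A 1} p) \<and>
         ((m = n \<and> sing_val A n > 0) \<or> ((\<lambda>z. f z / z) \<longlongrightarrow> 0) (at_right 0) \<longrightarrow>
          (\<exists>p. is_arg_min (err_norm_div f q {sing_val A (max m n)..sing_val A 1})
                 (\<lambda>p. degree p \<le> k - 1) p \<and>
           ennreal (norm2 (gen_mat_fun f A *\<^sub>v b - y))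
             \<le> ennreal (2 * norm2 (A *\<^sub>v b)) *
                 err_norm_div f q {sing_val A (max m n)..sing_val A 1} p))"
proof -
  obtain r U s V where cA: "compact_svd A = (r, U, s, V)" by (cases "compact_svd A") auto
  obtain r' U' s' V' where cB: "compact_svd B = (r', U', s', V')" by (cases "compact_svd B") auto
  note svdA = is_compact_svd_compact_svd[OF cA] and svdB = is_compact_svd_compact_svd[OF cB]
  have Pc: "P \<in> carrier_mat m k" "P\<^sup>T * P = 1\<^sub>m k" and Qc: "Q \<in> carrier_mat n k" "Q\<^sup>T * Q = 1\<^sub>m k"
    using P Q by (auto simp: real_onb_def)
  have Bc: "B \<in> carrier_mat k k"
    unfolding B by (rule mult_carrier_mat[OF mult_carrier_mat[OF _ A] Qc(1)]) (use Pc in simp)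
  note SA = is_compact_svdD[OF svdA A] and SB = is_compact_svdD[OF svdB Bc]
  define c where "c = Q\<^sup>T *\<^sub>v b"
  have c: "c \<in> carrier_vec k" using Qc b by (simp add: c_def)
  have Qcb: "Q *\<^sub>v c = b"
    unfolding c_def by (rule rational_krylov_exact(1)[OF A b k poles q Q P B svdA svdB])
  have PB: "P *\<^sub>v (B *\<^sub>v x) = A *\<^sub>v (Q *\<^sub>v x)" if "x \<in> carrier_vec k" for x
    by (rule rational_krylov_exact(2)[OF A b k poles q Q P B svdA svdB that])
  have normB: "norm2 (B *\<^sub>v x) = norm2 (A *\<^sub>v (Q *\<^sub>v x))" if "x \<in> carrier_vec k" for x
    using norm2_isometry[OF Pc mult_mat_vec_carrier[OF Bc that]] PB[OF that] by simp
  define xA where "xA = V\<^sup>T *\<^sub>v b"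
  define xB where "xB = V'\<^sup>T *\<^sub>v c"
  have x: "xA \<in> carrier_vec r" "xB \<in> carrier_vec r'"
    using SA(3) SB(3) b c by (auto simp: xA_def xB_def)
  have norm_x: "norm2 xA \<le> norm2 b" "norm2 xB \<le> norm2 b"
    using norm2_transpose_le[OF SA(3,4) b] norm2_transpose_le[OF SB(3,4) c] norm2_transpose_le[OF Qc b]
    by (auto simp: xA_def xB_def c_def)
  \<comment> \<open>For \<open>B\<close> the norm is that of \<open>B *\<^sub>v c\<close>, which
    equals that of \<open>A *\<^sub>v (Q *\<^sub>v c)\<close>, and \<open>Q *\<^sub>v c\<close> is
    \<open>b\<close>.\<close>
  have norm_sx: "norm2 (mat_diag r s *\<^sub>v xA) = norm2 (A *\<^sub>v b)"
    "norm2 (mat_diag r' s' *\<^sub>v xB) = norm2 (A *\<^sub>v b)"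
    using norm2_compact_svd_mult_vec[OF svdA A b] norm2_compact_svd_mult_vec[OF svdB Bc c] normB[OF c]
    by (simp_all add: xA_def xB_def Qcb)
  define err where "err = norm2 (gen_mat_fun f A *\<^sub>v b - y)"
  have err: "err = norm2 (U *\<^sub>v (mat_diag r (\<lambda>i. f (s i)) *\<^sub>v xA)
      - P *\<^sub>v (U' *\<^sub>v (mat_diag r' (\<lambda>i. f (s' i)) *\<^sub>v xB)))"
    using gen_mat_fun_mult_vec[OF cA A b, of f] gen_mat_fun_mult_vec[OF cB Bc c, of f]
    by (simp add: err_def y c_def xA_def xB_def)
  define I where "I = {sing_val A n..sing_val A 1}"
  define J where "J = {sing_val A (max m n)..sing_val A 1}"
  have sA: "s i \<in> I" if "i < r" for i
    unfolding I_def using sing_val_bounds[OF A]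
    by (intro compact_svd_singular_value_bounds[OF svdA A that]) auto
  have sB: "s' i \<in> I" if "i < r'" for i
    unfolding I_def
  proof (rule compact_svd_singular_value_bounds[OF svdB Bc that])
    fix x :: "real vec" assume x: "x \<in> carrier_vec k"
    have Qx: "Q *\<^sub>v x \<in> carrier_vec n" "norm2 (Q *\<^sub>v x) = norm2 x"
      using mult_mat_vec_carrier[OF Qc(1) x] norm2_isometry[OF Qc x] by auto
    show "sing_val A n * norm2 x \<le> norm2 (B *\<^sub>v x)" "norm2 (B *\<^sub>v x) \<le> sing_val A 1 * norm2 x"
      unfolding normB[OF x] Qx(2)[symmetric] using sing_val_bounds[OF A Qx(1)] by auto
  qed
  have IJ: "I \<subseteq> J" unfolding I_def J_def using sing_val_bounds(4)[OF A b] by auto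
  have bound: "err \<le> norm2 (mat_diag r (\<lambda>i. f (s i) - Re (R (s i) * complex_of_real (s i))) *\<^sub>v xA)
      + norm2 (mat_diag r' (\<lambda>i. f (s' i) - Re (R (s' i) * complex_of_real (s' i))) *\<^sub>v xB)"
    if "degree p \<le> k - 1" "\<And>z. z \<in> I \<Longrightarrow> ratfun_val p q (complex_of_real (z\<^sup>2)) = Some (R z)" for p R
    unfolding err
    by (rule compact_svd_error_split[OF SA(1,2) SB(1,2) Pc x, where f = f and s = s and s' = s'
          and \<rho> = "\<lambda>z. Re (R z * complex_of_real z)"], unfold xA_def xB_def c_def)
      (rule rational_krylov_exact(3)[OF A b k poles q Q P B svdA svdB that(1)
        that(2)[OF sA] that(2)[OF sB]])
  \<comment> \<open>The values of \<open>R\<close> may be complex, but \<open>f\<close> is real, so \<open>R\<close> can be replaced by its real part.\<close>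
  have bound1: "err \<le> 2 * norm2 b * C"
    if p: "degree p \<le> k - 1" and E: "err_norm f q I p \<le> ennreal C" and C: "0 \<le> C" for p C
  proof -
    from E have "\<forall>z\<in>I. \<exists>y. ratfun_val p q (complex_of_real (z\<^sup>2)) = Some y \<and>
        cmod (complex_of_real (f z) - y * complex_of_real z) \<le> C"
      unfolding err_norm_def sup_norm_le_iff[OF C] by fastforce
    then obtain R where R: "\<And>z. z \<in> I \<Longrightarrow> ratfun_val p q (complex_of_real (z\<^sup>2)) = Some (R z)"
      "\<And>z. z \<in> I \<Longrightarrow> cmod (complex_of_real (f z) - R z * complex_of_real z) \<le> C"
      by metis
    have Re: "\<bar>f z - Re (R z * complex_of_real z)\<bar> \<le> C" if "z \<in> I" for z
      using order_trans[OF abs_Re_le_cmod R(2)[OF that]] by simp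
    have "err \<le> norm2 (mat_diag r (\<lambda>i. f (s i) - Re (R (s i) * complex_of_real (s i))) *\<^sub>v xA)
        + norm2 (mat_diag r' (\<lambda>i. f (s' i) - Re (R (s' i) * complex_of_real (s' i))) *\<^sub>v xB)"
      by (rule bound[OF p R(1)])
    also have "\<dots> \<le> C * norm2 xA + C * norm2 xB"
      by (intro add_mono norm2_mat_diag_le x C Re sA sB)
    also have "\<dots> \<le> C * norm2 b + C * norm2 b"
      using norm_x C by (intro add_mono mult_left_mono) auto
    finally show ?thesis by (simp add: algebra_simps)
  qed
  \<comment> \<open>The factor \<open>s i\<close> is shifted onto the vector, where
    \<open>norm_sx\<close> evaluates it: here \<open>norm2 b\<close> is traded for
    \<open>norm2 (A *\<^sub>v b)\<close>.\<close>
  have scale: "norm2 (mat_diag r (\<lambda>i. h (s i) * s i) *\<^sub>v xA) + norm2 (mat_diag r' (\<lambda>i. h (s' i) * s' i) *\<^sub>v xB)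
      \<le> 2 * norm2 (A *\<^sub>v b) * C"
    if h: "\<And>i. i < r \<Longrightarrow> \<bar>h (s i)\<bar> \<le> C" "\<And>i. i < r' \<Longrightarrow> \<bar>h (s' i)\<bar> \<le> C" and C: "0 \<le> C"
    for h :: "real \<Rightarrow> real" and C
  proof -
    have "norm2 (mat_diag l (\<lambda>i. h (t i) * t i) *\<^sub>v z) \<le> C * norm2 (mat_diag l t *\<^sub>v z)"
      if "z \<in> carrier_vec l" "\<And>i. i < l \<Longrightarrow> \<bar>h (t i)\<bar> \<le> C" for l t z
      unfolding mat_diag_diag[symmetric] assoc_mult_mat_vec[OF mat_diag_dim mat_diag_dim that(1)]
      by (rule norm2_mat_diag_le[OF mult_mat_vec_carrier[OF mat_diag_dim that(1)] that(2) C])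
    from this[of xA r s, OF x(1) h(1)] this[of xB r' s', OF x(2) h(2)]
    show ?thesis unfolding norm_sx by (simp add: algebra_simps)
  qed
  have bound2: "err \<le> 2 * norm2 (A *\<^sub>v b) * C"
    if p: "degree p \<le> k - 1" and E: "err_norm_div f q J p \<le> ennreal C" and C: "0 \<le> C" for p C
  proof -
    from E have "\<forall>z\<in>J. \<exists>y. ratfun_val p q (complex_of_real (z\<^sup>2)) = Some y \<and>
        cmod (complex_of_real (f z / z) - y) \<le> C"
      unfolding err_norm_div_def sup_norm_le_iff[OF C] by fastforce
    then obtain R where R: "\<And>z. z \<in> J \<Longrightarrow> ratfun_val p q (complex_of_real (z\<^sup>2)) = Some (R z)"
      "\<And>z. z \<in> J \<Longrightarrow> cmod (complex_of_real (f z / z) - R z) \<le> C"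
      by metis
    define h where "h z = f z / z - Re (R z)" for z
    have h: "\<bar>h z\<bar> \<le> C" if "z \<in> I" for z
      using order_trans[OF abs_Re_le_cmod R(2)[of z]] that IJ by (auto simp: h_def)
    \<comment> \<open>Multiplying back by \<open>z\<close> needs \<open>z > 0\<close>, which the
      positive diagonals of both decompositions provide.\<close>
    have hz: "f z - Re (R z * complex_of_real z) = h z * z" if "z > 0" for z
      using that by (simp add: h_def field_simps)
    have "err \<le> norm2 (mat_diag r (\<lambda>i. f (s i) - Re (R (s i) * complex_of_real (s i))) *\<^sub>v xA)
        + norm2 (mat_diag r' (\<lambda>i. f (s' i) - Re (R (s' i) * complex_of_real (s' i))) *\<^sub>v xB)"
      by (rule bound[OF p R(1)]) (use IJ in blast)
    also have "mat_diag r (\<lambda>i. f (s i) - Re (R (s i) * complex_of_real (s i))) = mat_diag r (\<lambda>i. h (s i) * s i)"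
      using hz SA(5) by (auto simp: mat_diag_def intro!: eq_matI)
    also have "mat_diag r' (\<lambda>i. f (s' i) - Re (R (s' i) * complex_of_real (s' i))) = mat_diag r' (\<lambda>i. h (s' i) * s' i)"
      using hz SB(5) by (auto simp: mat_diag_def intro!: eq_matI)
    also have "norm2 (mat_diag r (\<lambda>i. h (s i) * s i) *\<^sub>v xA) + norm2 (mat_diag r' (\<lambda>i. h (s' i) * s' i) *\<^sub>v xB)
        \<le> 2 * norm2 (A *\<^sub>v b) * C"
      by (rule scale[OF h[OF sA] h[OF sB] C])
    finally show ?thesis .
  qed
  \<comment> \<open>In \<open>ennreal\<close> zero times infinity is zero, so a vanishing first
    factor needs its own argument when the error norm is infinite. The numerator is taken to be 0,
    and \<open>C\<close> is just some common bound for \<open>f z / z\<close> at the finitely many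
    singular values.\<close>
  have err0: "err = 0" if Ab: "norm2 (A *\<^sub>v b) = 0"
  proof -
    define h where "h z = f z / z" for z
    define C where "C = (\<Sum>i<r. \<bar>h (s i)\<bar>) + (\<Sum>i<r'. \<bar>h (s' i)\<bar>)"
    have "\<bar>h (s i)\<bar> \<le> C" if "i < r" for i
      unfolding C_def using member_le_sum[of i "{..<r}" "\<lambda>i. \<bar>h (s i)\<bar>"] that
      by (simp add: add_increasing2 sum_nonneg)
    moreover have "\<bar>h (s' i)\<bar> \<le> C" if "i < r'" for i
      unfolding C_def using member_le_sum[of i "{..<r'}" "\<lambda>i. \<bar>h (s' i)\<bar>"] that
      by (simp add: add_increasing sum_nonneg)
    moreover have "0 \<le> C" by (simp add: C_def sum_nonneg)
    ultimately have s0: "norm2 (mat_diag r (\<lambda>i. h (s i) * s i) *\<^sub>v xA)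
        + norm2 (mat_diag r' (\<lambda>i. h (s' i) * s' i) *\<^sub>v xB) \<le> 0"
      using scale[of h C] Ab by simp
    have "mat_diag r (\<lambda>i. f (s i)) = mat_diag r (\<lambda>i. h (s i) * s i)"
      "mat_diag r' (\<lambda>i. f (s' i)) = mat_diag r' (\<lambda>i. h (s' i) * s' i)"
      using SA(5) SB(5) by (force simp: mat_diag_def h_def intro!: eq_matI)+
    moreover have "q \<noteq> 0" by (auto simp: q pole_poly_def split: option.splits)
    hence "ratfun_val 0 q w = Some 0" for w
      using ratfun_val_cancel[of q 1 w 0] by simp
    ultimately have "err \<le> 0"
      using bound[of 0 "\<lambda>_. 0"] s0 by simp
    moreover have "0 \<le> err" by (simp add: err_def)
    ultimately show ?thesis by simp
  qed
  have err0': "err = 0" if "norm2 b = 0"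
  proof -
    have "norm2 (A *\<^sub>v b) \<le> 0" using sing_val_bounds(1)[OF A b] that by simp
    thus ?thesis using err0 norm2_nonneg[of "A *\<^sub>v b"] by linarith
  qed
  \<comment> \<open>For infinite \<open>E\<close> the right side is infinite unless \<open>a\<close>
    is 0, the case left to \<open>err0\<close> and \<open>err0'\<close>.\<close>
  have ennreal_bound: "ennreal err \<le> ennreal (2 * a) * E"
    if "0 \<le> a" "a = 0 \<Longrightarrow> err = 0" "\<And>C. E \<le> ennreal C \<Longrightarrow> 0 \<le> C \<Longrightarrow> err \<le> 2 * a * C" for a E
  proof (cases E)
    case (real C)
    thus ?thesis using that(1) that(3)[of C] by (simp add: ennreal_mult[symmetric] ennreal_leI)
  next
    case top
    thus ?thesis using that(1,2) by (cases "a = 0") (auto simp: ennreal_mult_top)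
  qed
  have 1: "ennreal err \<le> ennreal (2 * norm2 b) * err_norm f q I p" if "degree p \<le> k - 1" for p
    using bound1[OF that] err0' by (intro ennreal_bound) auto
  have 2: "ennreal err \<le> ennreal (2 * norm2 (A *\<^sub>v b)) * err_norm_div f q J p" if "degree p \<le> k - 1" for p
    using bound2[OF that] err0 by (intro ennreal_bound) auto
  obtain p1 where p1: "is_arg_min (err_norm f q I) (\<lambda>p. degree p \<le> k - 1) p1"
    using best_rational_approximation_exists[OF k, of I "\<lambda>z. complex_of_real (f z)" complex_of_real \<xi>]
    unfolding err_norm_def[abs_def] q by blast
  obtain p2 where p2: "is_arg_min (err_norm_div f q J) (\<lambda>p. degree p \<le> k - 1) p2"
    using best_rational_approximation_exists[OF k, of J "\<lambda>z. complex_of_real (f z / z)" "\<lambda>_. 1" \<xi>]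
    unfolding err_norm_div_def[abs_def] q by auto
  have "degree p1 \<le> k - 1" "degree p2 \<le> k - 1" using p1 p2 by (auto simp: is_arg_min_def)
  thus ?thesis
    using p1 p2 1 2 unfolding I_def J_def err_def by blast
qed

end
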